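(* Let $L$ be a Lie ring, $\gamma: L\to L$ a Lie ring endomorphism, and $r(t)=\sum_i a_it^i\in\mathbb{Z}[t]$ with $r(\gamma)=0_L$ (i.e. $\sum_i a_i\gamma^i(v)=0$ for all $v\in L$). Suppose $(L,+)$ has no $(\operatorname{Discr}_\ast(r(t))\cdot\operatorname{Prod}_\ast(r(t)))$-torsion. Then the Lie ring $\operatorname{Discr}_\ast(r(t))\cdot L$ can be embedded into a Lie ring $\overline{K}$ that is graded by the semigroup $(\overline{\mathbb{Q}},\cdot)$ and whose support is contained in the set $X$ of roots of $r(t)$ in $\overline{\mathbb{Q}}$.
   Context: A Lie ring $K$ is graded by a semigroup $(S,\cdot)$ if $K=\bigoplus_{s\in S}K_s$ as additive groups with $[K_s,K_{s'}]\subseteq K_{s s'}$; its support is $\{s: K_s\ne0\}$. If $r$ is constant, $\operatorname{Discr}_\ast(r):=r$, $\operatorname{Prod}_\ast(r):=1$. Otherwise, with $d=\deg r$, leading coefficient $a$, distinct roots $\lambda_1,\dots,\lambda_l\in\overline{\mathbb{Q}}$ of multiplicities $m_i$, $m=\max m_i$: $\operatorname{Discr}_\ast(r):=a^{1+2d^2}(m-1)!\prod_{i\ne j}(\lambda_i-\lambda_j)^m$ and $\operatorname{Prod}_\ast(r):=a^{2d^3}\prod_{1\le i,j\le l,\ r(\lambda_i\lambda_j)\ne0}r(\lambda_i\lambda_j)$. $(L,+)$ has $n$-torsion if some nonzero $v$ satisfies $nv=0$. *)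

theory Defs
  imports "HOL-Algebra.Ring" "HOL-Computational_Algebra.Polynomial" Complex_Main
begin

text \<open>A Lie ring: an abelian group (additive structure of a HOL-Algebra ring record)
  whose multiplication is read as the Lie bracket; the unit field of the record is ignored.\<close>
definition lie_ring :: "('a, 'b) ring_scheme \<Rightarrow> bool" where
  "lie_ring R \<longleftrightarrow> abelian_group R \<and>
     (\<forall>x\<in>carrier R. \<forall>y\<in>carrier R. x \<otimes>\<^bsub>R\<^esub> y \<in> carrier R) \<and>
     (\<forall>x\<in>carrier R. \<forall>y\<in>carrier R. \<forall>z\<in>carrier R.
        (x \<oplus>\<^bsub>R\<^esub> y) \<otimes>\<^bsub>R\<^esub> z = (x \<otimes>\<^bsub>R\<^esub> z) \<oplus>\<^bsub>R\<^esub> (y \<otimes>\<^bsub>R\<^esub> z) \<and>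
        z \<otimes>\<^bsub>R\<^esub> (x \<oplus>\<^bsub>R\<^esub> y) = (z \<otimes>\<^bsub>R\<^esub> x) \<oplus>\<^bsub>R\<^esub> (z \<otimes>\<^bsub>R\<^esub> y) \<and>
        (x \<otimes>\<^bsub>R\<^esub> (y \<otimes>\<^bsub>R\<^esub> z)) \<oplus>\<^bsub>R\<^esub> (y \<otimes>\<^bsub>R\<^esub> (z \<otimes>\<^bsub>R\<^esub> x))
          \<oplus>\<^bsub>R\<^esub> (z \<otimes>\<^bsub>R\<^esub> (x \<otimes>\<^bsub>R\<^esub> y)) = \<zero>\<^bsub>R\<^esub>) \<and>
     (\<forall>x\<in>carrier R. x \<otimes>\<^bsub>R\<^esub> x = \<zero>\<^bsub>R\<^esub>)"

definition lie_endo :: "('a, 'b) ring_scheme \<Rightarrow> ('a \<Rightarrow> 'a) \<Rightarrow> bool" where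
  "lie_endo L g \<longleftrightarrow> g \<in> carrier L \<rightarrow> carrier L \<and>
     (\<forall>x\<in>carrier L. \<forall>y\<in>carrier L.
        g (x \<oplus>\<^bsub>L\<^esub> y) = g x \<oplus>\<^bsub>L\<^esub> g y \<and> g (x \<otimes>\<^bsub>L\<^esub> y) = g x \<otimes>\<^bsub>L\<^esub> g y)"

definition poly_annihilates :: "int poly \<Rightarrow> ('a, 'b) ring_scheme \<Rightarrow> ('a \<Rightarrow> 'a) \<Rightarrow> bool" where
  "poly_annihilates r L g \<longleftrightarrow>
     (\<forall>v\<in>carrier L. (\<Oplus>\<^bsub>L\<^esub> i\<in>{..degree r}. [coeff r i] \<cdot>\<^bsub>L\<^esub> ((g ^^ i) v)) = \<zero>\<^bsub>L\<^esub>)"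

definition has_torsion :: "('a, 'b) ring_scheme \<Rightarrow> int \<Rightarrow> bool" where
  "has_torsion L n \<longleftrightarrow> (\<exists>v\<in>carrier L. v \<noteq> \<zero>\<^bsub>L\<^esub> \<and> [n] \<cdot>\<^bsub>L\<^esub> v = \<zero>\<^bsub>L\<^esub>)"

text \<open>Distinct roots of r in the algebraic closure (taken inside \<complex>; all complex roots of a
  nonzero integer polynomial are algebraic).\<close>
definition roots_c :: "int poly \<Rightarrow> complex set" where
  "roots_c r = {x. poly (map_poly of_int r) x = 0}"

definition Discr_star :: "int poly \<Rightarrow> complex" where
  "Discr_star r =
    (if degree r = 0 then of_int (coeff r 0)
     else (let d = degree r; a = of_int (lead_coeff r) :: complex; rc = map_poly of_int r;
               R = roots_c r; m = Max ((\<lambda>x. order x rc) ` R) in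
           a ^ (1 + 2 * d\<^sup>2) * of_nat (fact (m - 1)) *
           (\<Prod>(x, y)\<in>{(x, y). x \<in> R \<and> y \<in> R \<and> x \<noteq> y}. (x - y) ^ m)))"

definition Prod_star :: "int poly \<Rightarrow> complex" where
  "Prod_star r =
    (if degree r = 0 then 1
     else (let d = degree r; a = of_int (lead_coeff r) :: complex; rc = map_poly of_int r;
               R = roots_c r in
           a ^ (2 * d ^ 3) *
           (\<Prod>(x, y)\<in>{(x, y). x \<in> R \<and> y \<in> R \<and> poly rc (x * y) \<noteq> 0}. poly rc (x * y))))"

text \<open>K is graded by the multiplicative semigroup of algebraic numbers via the family Kc
  (only the components Kc s with s algebraic matter): each Kc s is an additive subgroup,
  [K_s, K_s'] \<subseteq> K_{ss'}, and K is the internal direct sum of the Kc s.\<close>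
definition alg_graded :: "('k, 'b) ring_scheme \<Rightarrow> (complex \<Rightarrow> 'k set) \<Rightarrow> bool" where
  "alg_graded K Kc \<longleftrightarrow>
     (\<forall>s. algebraic s \<longrightarrow> subgroup (Kc s) (add_monoid K)) \<and>
     (\<forall>s s' x y. algebraic s \<longrightarrow> algebraic s' \<longrightarrow> x \<in> Kc s \<longrightarrow> y \<in> Kc s' \<longrightarrow>
        x \<otimes>\<^bsub>K\<^esub> y \<in> Kc (s * s')) \<and>
     (\<forall>x\<in>carrier K. \<exists>!f. (\<forall>s. algebraic s \<longrightarrow> f s \<in> Kc s) \<and>
        (\<forall>s. \<not> algebraic s \<longrightarrow> f s = \<zero>\<^bsub>K\<^esub>) \<and>
        finite {s. f s \<noteq> \<zero>\<^bsub>K\<^esub>} \<and>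
        x = (\<Oplus>\<^bsub>K\<^esub> s\<in>{s. f s \<noteq> \<zero>\<^bsub>K\<^esub>}. f s))"

definition grading_support :: "('k, 'b) ring_scheme \<Rightarrow> (complex \<Rightarrow> 'k set) \<Rightarrow> complex set" where
  "grading_support K Kc = {s. algebraic s \<and> Kc s \<noteq> {\<zero>\<^bsub>K\<^esub>}}"

definition scaled_carrier :: "int \<Rightarrow> ('a, 'b) ring_scheme \<Rightarrow> 'a set" where
  "scaled_carrier n L = (\<lambda>v. [n] \<cdot>\<^bsub>L\<^esub> v) ` carrier L"

definition lie_embedding_on :: "'a set \<Rightarrow> ('a, 'b) ring_scheme \<Rightarrow> ('k, 'c) ring_scheme \<Rightarrow> ('a \<Rightarrow> 'k) \<Rightarrow> bool" where
  "lie_embedding_on A L K f \<longleftrightarrow> inj_on f A \<and> f ` A \<subseteq> carrier K \<and>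
     (\<forall>x\<in>A. \<forall>y\<in>A. f (x \<oplus>\<^bsub>L\<^esub> y) = f x \<oplus>\<^bsub>K\<^esub> f y \<and> f (x \<otimes>\<^bsub>L\<^esub> y) = f x \<otimes>\<^bsub>K\<^esub> f y)"

end

theory Submission
  imports Defs "HOL-Computational_Algebra.Fundamental_Theorem_Algebra"
begin

text \<open>
  Let \<open>a\<close> be the leading coefficient of \<open>r\<close> and \<open>N = Discr_star r * Prod_star r\<close>. The ring \<open>O\<close> generated
  by the algebraic integers \<open>a * x\<close>, for \<open>x\<close> a root of \<open>r\<close>, is a free abelian group of finite rank, so
  \<open>L\<close> embeds into \<open>L \<otimes> O\<close>, which again has no \<open>N\<close>-torsion and hence embeds into its localization \<open>K\<close>
  at \<open>N\<close>. Counting exponents shows that \<open>a\<close> divides \<open>N\<close> in \<open>O\<close>; therefore the roots of \<open>r\<close>, the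
  inverses of \<open>x - y\<close> for distinct roots and the inverses of \<open>x * y - z\<close> whenever \<open>x * y \<noteq> z\<close>
  all lie in \<open>O[1/N]\<close>. Over this ring \<open>K\<close> is the direct sum of the generalized eigenspaces of \<open>\<gamma>\<close> at
  the roots of \<open>r\<close>, and the bracket of the eigenspaces at \<open>x\<close> and \<open>y\<close> lies in the eigenspace at \<open>x * y\<close>,
  which vanishes if \<open>x * y\<close> is not a root.
\<close>

subsection \<open>Lie algebras over subrings of the complex numbers and generalized eigenspaces\<close>

text \<open>The roots become integral only after scaling by \<open>a\<close>, so a scalar ring that
  is finitely generated as a group need not contain them. This forces two stages. Freeness of
  \<open>O\<close> makes torsion a matter of coordinates, which turns the hypothesis on
  \<open>L\<close> into injectivity of \<open>N\<close> on \<open>L \<otimes> O\<close>; only then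
  is \<open>N\<close> inverted and the roots become available. The powers of \<open>a\<close> in
  \<open>Discr_star\<close> and \<open>Prod_star\<close> are large enough to clear the denominators
  of all other factors with one \<open>a\<close> to spare, and that spare factor makes
  \<open>a\<close> a unit.

  Over the localized ring everything about eigenspaces rests on the identity
  \<open>(t - c) - (t - d) = d - c\<close>, whose right side is a unit for distinct roots.

  The carrier type is prescribed: \<open>K\<close> has to live on lists over
  \<open>'a \<times> complex\<close>. Finiteness of a basis of \<open>O\<close> lets a coordinate
  vector together with an exponent of \<open>N\<close> be coded as such a list, so fractions are
  represented by codes of chosen pairs.\<close>

lemma additive_map:
  assumes "abelian_group G" "abelian_group H"
    and cl: "\<And>x. x \<in> carrier G \<Longrightarrow> h x \<in> carrier H"
    and add: "\<And>x y. x \<in> carrier G \<Longrightarrow> y \<in> carrier G \<Longrightarrow> h (x \<oplus>\<^bsub>G\<^esub> y) = h x \<oplus>\<^bsub>H\<^esub> h y"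
  shows additive_zero: "h \<zero>\<^bsub>G\<^esub> = \<zero>\<^bsub>H\<^esub>"
    and additive_minus: "x \<in> carrier G \<Longrightarrow> h (\<ominus>\<^bsub>G\<^esub> x) = \<ominus>\<^bsub>H\<^esub> h x"
    and additive_int_mult: "x \<in> carrier G \<Longrightarrow> h ([n] \<cdot>\<^bsub>G\<^esub> x) = [(n::int)] \<cdot>\<^bsub>H\<^esub> (h x)"
    and additive_finsum: "f \<in> I \<rightarrow> carrier G \<Longrightarrow> h (finsum G f I) = finsum H (\<lambda>i. h (f i)) I"
proof -
  interpret G: abelian_group G by fact
  interpret H: abelian_group H by fact
  interpret h: group_hom "add_monoid G" "add_monoid H" h
    using G.a_group H.a_group cl add by (auto simp: group_hom_def group_hom_axioms_def hom_def)
  show z: "h \<zero>\<^bsub>G\<^esub> = \<zero>\<^bsub>H\<^esub>" using h.hom_one by simp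
  show "x \<in> carrier G \<Longrightarrow> h (\<ominus>\<^bsub>G\<^esub> x) = \<ominus>\<^bsub>H\<^esub> h x" using h.hom_inv by (simp add: a_inv_def)
  show "x \<in> carrier G \<Longrightarrow> h ([n] \<cdot>\<^bsub>G\<^esub> x) = [n] \<cdot>\<^bsub>H\<^esub> (h x)"
    using h.hom_int_pow by (simp add: add_pow_def)
  show "f \<in> I \<rightarrow> carrier G \<Longrightarrow> h (finsum G f I) = finsum H (\<lambda>i. h (f i)) I"
    by (induction I rule: infinite_finite_induct) (auto simp: z add cl Pi_iff)
qed

text \<open>Polynomials over \<open>A\<close> stay complex polynomials with this side condition,
  because \<open>A\<close> is a varying set: the span of a basis, then its localization.\<close>

definition coeffs_in :: "complex set \<Rightarrow> complex poly \<Rightarrow> bool" where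
  "coeffs_in A p \<longleftrightarrow> (\<forall>i. coeff p i \<in> A)"

definition lin :: "complex \<Rightarrow> complex poly" where
  "lin c = [:- c, 1:]"

section \<open>Subrings of the complex numbers and polynomials over them\<close>

locale subring_c =
  fixes A :: "complex set"
  assumes one_in [simp, intro]: "1 \<in> A"
    and diff_in [simp, intro]: "a \<in> A \<Longrightarrow> b \<in> A \<Longrightarrow> a - b \<in> A"
    and mult_in [simp, intro]: "a \<in> A \<Longrightarrow> b \<in> A \<Longrightarrow> a * b \<in> A"
begin

lemma zero_in [simp, intro]: "0 \<in> A"
  using diff_in[of 1 1] by simp

lemma uminus_in [simp, intro]: "a \<in> A \<Longrightarrow> - a \<in> A"
  using diff_in[of 0 a] by simp

lemma add_in [simp, intro]: "a \<in> A \<Longrightarrow> b \<in> A \<Longrightarrow> a + b \<in> A"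
  using diff_in[of a "- b"] by simp

lemma power_in [simp, intro]: "a \<in> A \<Longrightarrow> a ^ n \<in> A"
  by (induction n) auto

lemma sum_in [intro]: "(\<And>i. i \<in> I \<Longrightarrow> f i \<in> A) \<Longrightarrow> sum f I \<in> A"
  by (induction I rule: infinite_finite_induct) auto

lemma prod_in [intro]: "(\<And>i. i \<in> I \<Longrightarrow> f i \<in> A) \<Longrightarrow> prod f I \<in> A"
  by (induction I rule: infinite_finite_induct) auto

lemma of_nat_in [simp, intro]: "of_nat n \<in> A"
  by (induction n) auto

lemma of_int_in [simp, intro]: "of_int n \<in> A"
  by (cases n rule: int_cases2) auto

text \<open>Since \<open>1/c = d/e\<close>. Applied to factorizations of \<open>N\<close>, this
  yields all the inverses that the eigenspace argument consumes.\<close>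

lemma inverse_factor_in:
  assumes "c * d = e" "d \<in> A" "e \<noteq> 0" "inverse e \<in> A"
  shows "inverse c \<in> A"
proof -
  have "inverse c = d * inverse e" using assms(1,3) by (auto simp: field_simps)
  then show ?thesis using assms by auto
qed

lemma coeffs_in_pCons [simp]: "coeffs_in A (pCons c p) \<longleftrightarrow> c \<in> A \<and> coeffs_in A p"
  by (auto simp: coeffs_in_def coeff_pCons split: nat.splits)

lemma coeffs_in_0 [simp]: "coeffs_in A 0"
  by (simp add: coeffs_in_def)

lemma coeffs_in_1 [simp]: "coeffs_in A 1"
  by (simp add: one_pCons)

lemma coeffs_in_smult: "c \<in> A \<Longrightarrow> coeffs_in A p \<Longrightarrow> coeffs_in A (smult c p)"
  by (simp add: coeffs_in_def)

lemma coeffs_in_mult [simp]: "coeffs_in A p \<Longrightarrow> coeffs_in A q \<Longrightarrow> coeffs_in A (p * q)"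
  unfolding coeffs_in_def coeff_mult by auto

lemma coeffs_in_power [simp]: "coeffs_in A p \<Longrightarrow> coeffs_in A (p ^ n)"
  by (induction n) auto

lemma coeffs_in_prod: "(\<And>i. i \<in> I \<Longrightarrow> coeffs_in A (f i)) \<Longrightarrow> coeffs_in A (prod f I)"
  by (induction I rule: infinite_finite_induct) auto

lemma coeffs_in_lin [simp]: "c \<in> A \<Longrightarrow> coeffs_in A (lin c)"
  by (simp add: lin_def)

lemma coeffs_in_of_int: "coeffs_in A (map_poly of_int r)"
  by (simp add: coeffs_in_def coeff_map_poly)

end

section \<open>Lie rings and Lie algebras over a subring\<close>

locale Lie_ring = fixes M (structure)
  assumes lie_ring: "lie_ring M"
begin

sublocale abelian_group M
  using lie_ring by (simp add: lie_ring_def)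

lemma bracket_closed [simp, intro]: "x \<in> carrier M \<Longrightarrow> y \<in> carrier M \<Longrightarrow> x \<otimes> y \<in> carrier M"
  and bracket_add_left: "x \<in> carrier M \<Longrightarrow> y \<in> carrier M \<Longrightarrow> z \<in> carrier M \<Longrightarrow>
    (x \<oplus> y) \<otimes> z = (x \<otimes> z) \<oplus> (y \<otimes> z)"
  and bracket_add_right: "x \<in> carrier M \<Longrightarrow> y \<in> carrier M \<Longrightarrow> z \<in> carrier M \<Longrightarrow>
    z \<otimes> (x \<oplus> y) = (z \<otimes> x) \<oplus> (z \<otimes> y)"
  and bracket_self [simp]: "x \<in> carrier M \<Longrightarrow> x \<otimes> x = \<zero>"
  and jacobi: "x \<in> carrier M \<Longrightarrow> y \<in> carrier M \<Longrightarrow> z \<in> carrier M \<Longrightarrow>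
    (x \<otimes> (y \<otimes> z)) \<oplus> (y \<otimes> (z \<otimes> x)) \<oplus> (z \<otimes> (x \<otimes> y)) = \<zero>"
  using lie_ring unfolding lie_ring_def by blast+

lemma bracket_zero_left [simp]: "x \<in> carrier M \<Longrightarrow> \<zero> \<otimes> x = \<zero>"
  by (rule additive_zero[OF abelian_group_axioms abelian_group_axioms, of "\<lambda>y. y \<otimes> x"])
    (auto simp: bracket_add_left)

lemma bracket_zero_right [simp]: "x \<in> carrier M \<Longrightarrow> x \<otimes> \<zero> = \<zero>"
  by (rule additive_zero[OF abelian_group_axioms abelian_group_axioms, of "\<lambda>y. x \<otimes> y"])
    (auto simp: bracket_add_right)

lemma bracket_minus_left: "x \<in> carrier M \<Longrightarrow> y \<in> carrier M \<Longrightarrow> (\<ominus> y) \<otimes> x = \<ominus> (y \<otimes> x)"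
  by (rule additive_minus[OF abelian_group_axioms abelian_group_axioms, of "\<lambda>y. y \<otimes> x"])
    (auto simp: bracket_add_left)

lemma bracket_minus_right: "x \<in> carrier M \<Longrightarrow> y \<in> carrier M \<Longrightarrow> x \<otimes> (\<ominus> y) = \<ominus> (x \<otimes> y)"
  by (rule additive_minus[OF abelian_group_axioms abelian_group_axioms, of "\<lambda>y. x \<otimes> y"])
    (auto simp: bracket_add_right)

lemma bracket_int_left:
  "x \<in> carrier M \<Longrightarrow> y \<in> carrier M \<Longrightarrow> ([(n::int)] \<cdot> y) \<otimes> x = [n] \<cdot> (y \<otimes> x)"
  by (rule additive_int_mult[OF abelian_group_axioms abelian_group_axioms, of "\<lambda>y. y \<otimes> x"])
    (auto simp: bracket_add_left)

lemma bracket_int_right: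
  "x \<in> carrier M \<Longrightarrow> y \<in> carrier M \<Longrightarrow> x \<otimes> ([(n::int)] \<cdot> y) = [n] \<cdot> (x \<otimes> y)"
  by (rule additive_int_mult[OF abelian_group_axioms abelian_group_axioms, of "\<lambda>y. x \<otimes> y"])
    (auto simp: bracket_add_right)

lemma bracket_antisym:
  assumes [simp]: "x \<in> carrier M" "y \<in> carrier M"
  shows "x \<otimes> y = \<ominus> (y \<otimes> x)"
proof -
  have "(x \<oplus> y) \<otimes> (x \<oplus> y) = (x \<otimes> y) \<oplus> (y \<otimes> x)"
    by (subst bracket_add_left) (simp_all add: bracket_add_right)
  then have "(x \<otimes> y) \<oplus> (y \<otimes> x) = \<zero>" by simp
  then show ?thesis by (simp add: minus_equality)
qed

end

text \<open>Instantiated twice: by \<open>L \<otimes> O\<close> over the span of a basis, and by its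
  localization over the ring of fractions. Compatibility with the right argument of the bracket
  follows by antisymmetry.\<close>

locale Lie_algebra = subring_c A + Lie_ring M for A and M (structure) +
  fixes s :: "complex \<Rightarrow> 'a \<Rightarrow> 'a"
  assumes s_closed [simp, intro]: "c \<in> A \<Longrightarrow> x \<in> carrier M \<Longrightarrow> s c x \<in> carrier M"
    and s_add_left: "c \<in> A \<Longrightarrow> d \<in> A \<Longrightarrow> x \<in> carrier M \<Longrightarrow> s (c + d) x = s c x \<oplus> s d x"
    and s_add_right: "c \<in> A \<Longrightarrow> x \<in> carrier M \<Longrightarrow> y \<in> carrier M \<Longrightarrow>
      s c (x \<oplus> y) = s c x \<oplus> s c y"
    and s_mult: "c \<in> A \<Longrightarrow> d \<in> A \<Longrightarrow> x \<in> carrier M \<Longrightarrow> s (c * d) x = s c (s d x)"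
    and s_one [simp]: "x \<in> carrier M \<Longrightarrow> s 1 x = x"
    and s_bracket_left: "c \<in> A \<Longrightarrow> x \<in> carrier M \<Longrightarrow> y \<in> carrier M \<Longrightarrow>
      s c (x \<otimes> y) = s c x \<otimes> y"
begin

lemma s_zero_right [simp]: "c \<in> A \<Longrightarrow> s c \<zero> = \<zero>"
  by (rule additive_zero[OF abelian_group_axioms abelian_group_axioms, of "s c"])
    (auto simp: s_add_right)

lemma s_minus_right: "c \<in> A \<Longrightarrow> x \<in> carrier M \<Longrightarrow> s c (\<ominus> x) = \<ominus> s c x"
  by (rule additive_minus[OF abelian_group_axioms abelian_group_axioms, of "s c"])
    (auto simp: s_add_right)

lemma s_zero_left [simp]: assumes [simp]: "x \<in> carrier M" shows "s 0 x = \<zero>"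
proof -
  have "s 0 x \<oplus> s 0 x = s 0 x \<oplus> \<zero>" using s_add_left[of 0 0 x] by simp
  then show ?thesis by simp
qed

lemma s_minus_left: assumes [simp]: "c \<in> A" "x \<in> carrier M" shows "s (- c) x = \<ominus> s c x"
proof -
  have "s (- c) x \<oplus> s c x = \<zero>" using s_add_left[of "- c" c x] by simp
  then show ?thesis by (simp add: minus_equality)
qed

lemma s_bracket_right:
  assumes [simp]: "c \<in> A" "x \<in> carrier M" "y \<in> carrier M"
  shows "s c (x \<otimes> y) = x \<otimes> s c y"
  using s_bracket_left[of c y x]
  by (simp add: bracket_antisym[of x y] bracket_antisym[of x "s c y"] s_minus_right)

lemma s_commute: "c \<in> A \<Longrightarrow> d \<in> A \<Longrightarrow> x \<in> carrier M \<Longrightarrow> s c (s d x) = s d (s c x)"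
  by (metis s_mult mult.commute)

lemma s_of_int: assumes [simp]: "x \<in> carrier M" shows "s (of_int n) x = [n] \<cdot> x"
proof -
  have nat: "s (of_nat k) x = [int k] \<cdot> x" for k
  proof (induction k)
    case 0
    show ?case by (simp add: add_pow_def)
  qed (simp add: add.int_pow_mult s_add_left)
  show ?thesis
    by (cases n rule: int_cases2) (simp_all add: nat s_minus_left add.int_pow_neg)
qed

lemma s_inverse_cancel:
  assumes "c \<in> A" "c \<noteq> 0" "inverse c \<in> A" "x \<in> carrier M" "s c x = \<zero>"
  shows "x = \<zero>"
  using s_mult[of "inverse c" c x] assms by simp

end

text \<open>Uses only additive operations and \<open>g\<close>, so the value passes through every
  additive map that commutes with the endomorphisms; \<open>act_of_int\<close> identifies it with
  the action of complex polynomials.\<close>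

definition horner :: "('a, 'b) ring_scheme \<Rightarrow> ('a \<Rightarrow> 'a) \<Rightarrow> int poly \<Rightarrow> 'a \<Rightarrow> 'a" where
  "horner L g r v = foldr (\<lambda>c w. [c] \<cdot>\<^bsub>L\<^esub> v \<oplus>\<^bsub>L\<^esub> g w) (coeffs r) \<zero>\<^bsub>L\<^esub>"

section \<open>Evaluation of polynomials at an endomorphism\<close>

locale Lie_algebra_endo = Lie_algebra A M s for A and M (structure) and s +
  fixes g :: "'a \<Rightarrow> 'a"
  assumes endo: "lie_endo M g"
    and g_s: "c \<in> A \<Longrightarrow> x \<in> carrier M \<Longrightarrow> g (s c x) = s c (g x)"
begin

lemma g_closed [simp, intro]: "x \<in> carrier M \<Longrightarrow> g x \<in> carrier M"
  and g_add: "x \<in> carrier M \<Longrightarrow> y \<in> carrier M \<Longrightarrow> g (x \<oplus> y) = g x \<oplus> g y"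
  and g_bracket: "x \<in> carrier M \<Longrightarrow> y \<in> carrier M \<Longrightarrow> g (x \<otimes> y) = g x \<otimes> g y"
  using endo unfolding lie_endo_def by blast+

lemma g_zero [simp]: "g \<zero> = \<zero>"
  by (rule additive_zero[OF abelian_group_axioms abelian_group_axioms, of g]) (auto simp: g_add)

text \<open>Horner's scheme, so that the laws of a module over \<open>A[t]\<close> follow by
  induction along \<open>pCons\<close>.\<close>

definition act :: "complex poly \<Rightarrow> 'a \<Rightarrow> 'a" where
  "act p v = foldr (\<lambda>c w. s c v \<oplus> g w) (coeffs p) \<zero>"

lemma act_0 [simp]: "act 0 v = \<zero>"
  by (simp add: act_def)

lemma act_pCons: "v \<in> carrier M \<Longrightarrow> act (pCons c p) v = s c v \<oplus> g (act p v)"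
  by (simp add: act_def coeffs_pCons_eq_cCons cCons_def)

lemma act_closed [simp, intro]: "coeffs_in A p \<Longrightarrow> v \<in> carrier M \<Longrightarrow> act p v \<in> carrier M"
  by (induction p) (simp_all add: act_pCons)

lemma act_1 [simp]: "v \<in> carrier M \<Longrightarrow> act 1 v = v"
  by (simp add: one_pCons act_pCons)

lemma act_add_right:
  "coeffs_in A p \<Longrightarrow> v \<in> carrier M \<Longrightarrow> w \<in> carrier M \<Longrightarrow> act p (v \<oplus> w) = act p v \<oplus> act p w"
  by (induction p) (simp_all add: act_pCons s_add_right g_add a_ac)

lemma act_zero_right [simp]: "coeffs_in A p \<Longrightarrow> act p \<zero> = \<zero>"
  by (induction p) (simp_all add: act_pCons)

lemma act_s: "coeffs_in A p \<Longrightarrow> c \<in> A \<Longrightarrow> v \<in> carrier M \<Longrightarrow> act p (s c v) = s c (act p v)"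
  by (induction p) (simp_all add: act_pCons s_add_right g_s s_commute)

lemma act_g: "coeffs_in A p \<Longrightarrow> v \<in> carrier M \<Longrightarrow> act p (g v) = g (act p v)"
  by (induction p) (simp_all add: act_pCons g_add g_s)

lemma act_add_left:
  "coeffs_in A p \<Longrightarrow> coeffs_in A q \<Longrightarrow> v \<in> carrier M \<Longrightarrow> act (p + q) v = act p v \<oplus> act q v"
proof (induction p arbitrary: q)
  case (pCons c p)
  then show ?case
    by (cases q) (simp_all add: act_pCons s_add_left g_add a_ac)
qed simp

lemma act_smult:
  "coeffs_in A p \<Longrightarrow> c \<in> A \<Longrightarrow> v \<in> carrier M \<Longrightarrow> act (smult c p) v = s c (act p v)"
  by (induction p) (simp_all add: act_pCons s_add_right s_mult g_s)

lemma act_mult: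
  "coeffs_in A p \<Longrightarrow> coeffs_in A q \<Longrightarrow> v \<in> carrier M \<Longrightarrow> act (p * q) v = act p (act q v)"
  by (induction p) (simp_all add: act_pCons act_add_left act_smult coeffs_in_smult)

lemma act_commute:
  "coeffs_in A p \<Longrightarrow> coeffs_in A q \<Longrightarrow> v \<in> carrier M \<Longrightarrow> act p (act q v) = act q (act p v)"
  by (simp add: act_mult[symmetric] mult.commute)

lemma act_power_Suc:
  "coeffs_in A p \<Longrightarrow> v \<in> carrier M \<Longrightarrow> act (p ^ Suc n) v = act (p ^ n) (act p v)"
  by (simp only: power_Suc2 act_mult coeffs_in_power)

lemma act_of_int: "v \<in> carrier M \<Longrightarrow> act (map_poly of_int r) v = horner M g r v"
proof -
  assume v: "v \<in> carrier M"
  have "coeffs (map_poly (of_int :: int \<Rightarrow> complex) r) = map of_int (coeffs r)"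
    by (intro coeffs_map_poly') auto
  then show ?thesis
    using v by (simp add: act_def horner_def foldr_map comp_def s_of_int)
qed

section \<open>Generalized eigenspaces\<close>

definition eig :: "complex \<Rightarrow> 'a set" where
  "eig c = {v \<in> carrier M. \<exists>n. act (lin c ^ n) v = \<zero>}"

lemma eig_zero [simp, intro]: "c \<in> A \<Longrightarrow> \<zero> \<in> eig c"
  by (auto simp: eig_def)

lemma eig_carrier: "v \<in> eig c \<Longrightarrow> v \<in> carrier M"
  by (simp add: eig_def)

lemma act_power_mono:
  assumes "c \<in> A" "v \<in> carrier M" "act (lin c ^ n) v = \<zero>" "n \<le> m"
  shows "act (lin c ^ m) v = \<zero>"
proof -
  have "lin c ^ m = lin c ^ (m - n) * lin c ^ n"
    using assms(4) by (simp flip: power_add)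
  then show ?thesis using assms by (simp add: act_mult)
qed

lemma eig_add: assumes "c \<in> A" "v \<in> eig c" "w \<in> eig c" shows "v \<oplus> w \<in> eig c"
proof -
  obtain n m where nm: "act (lin c ^ n) v = \<zero>" "act (lin c ^ m) w = \<zero>"
    and vw: "v \<in> carrier M" "w \<in> carrier M"
    using assms by (auto simp: eig_def)
  have "act (lin c ^ (max n m)) (v \<oplus> w) = \<zero>"
    using vw act_power_mono[OF assms(1) vw(1) nm(1), of "max n m"]
      act_power_mono[OF assms(1) vw(2) nm(2), of "max n m"] assms(1)
    by (simp add: act_add_right)
  then show ?thesis using vw by (auto simp: eig_def)
qed

lemma eig_act: "c \<in> A \<Longrightarrow> coeffs_in A p \<Longrightarrow> v \<in> eig c \<Longrightarrow> act p v \<in> eig c"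
proof -
  assume a: "c \<in> A" "coeffs_in A p" "v \<in> eig c"
  then obtain n where n: "act (lin c ^ n) v = \<zero>" and v: "v \<in> carrier M"
    by (auto simp: eig_def)
  have "act (lin c ^ n) (act p v) = act p (act (lin c ^ n) v)"
    using a v by (intro act_commute) auto
  then show ?thesis using n a v by (auto simp: eig_def)
qed

lemma eig_s: "c \<in> A \<Longrightarrow> d \<in> A \<Longrightarrow> v \<in> eig c \<Longrightarrow> s d v \<in> eig c"
  using eig_act[of c "[:d:]" v] by (simp add: act_pCons eig_def)

lemma eig_minus: "c \<in> A \<Longrightarrow> v \<in> eig c \<Longrightarrow> \<ominus> v \<in> eig c"
  using eig_s[of c "- 1" v] by (simp add: s_minus_left eig_carrier)

lemma eig_subgroup: "c \<in> A \<Longrightarrow> subgroup (eig c) (add_monoid M)"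
  by (rule add.subgroupI) (auto simp: eig_carrier eig_minus eig_add simp flip: a_inv_def)

lemma act_linear: "c \<in> A \<Longrightarrow> v \<in> carrier M \<Longrightarrow> act (lin c) v = g v \<ominus> s c v"
  by (simp add: lin_def act_pCons s_minus_left minus_eq a_comm)

lemma eig_linearD: assumes "c \<in> A" "v \<in> carrier M" "act (lin c) v \<in> eig c" shows "v \<in> eig c"
proof -
  obtain n where "act (lin c ^ n) (act (lin c) v) = \<zero>"
    using assms by (auto simp: eig_def)
  then have "act (lin c ^ Suc n) v = \<zero>"
    using assms by (simp only: power_Suc2) (simp add: act_mult)
  then show ?thesis using assms(2) unfolding eig_def by blast
qed

text \<open>Both sides are \<open>g x \<otimes> g y\<close> minus
  \<open>s c x \<otimes> s d y\<close>: the mixed term \<open>s c x \<otimes> g y\<close> is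
  subtracted in one summand and added in the other.\<close>

lemma act_linear_bracket:
  assumes [simp]: "c \<in> A" "d \<in> A" "x \<in> carrier M" "y \<in> carrier M"
  shows "act (lin (c * d)) (x \<otimes> y) = (act (lin c) x \<otimes> g y) \<oplus> (s c x \<otimes> act (lin d) y)"
proof -
  have e: "s (c * d) (x \<otimes> y) = s c x \<otimes> s d y"
    using s_bracket_right[of d "s c x" y] by (simp add: s_mult s_bracket_left s_commute)
  have f: "a \<oplus> \<ominus> b \<oplus> (b \<oplus> \<ominus> d) = a \<oplus> \<ominus> d"
    if "a \<in> carrier M" "b \<in> carrier M" "d \<in> carrier M" for a b d
    using that by (metis a_assoc a_inv_closed a_closed l_neg l_zero)
  show ?thesis
    by (simp add: act_linear e minus_eq bracket_add_left bracket_add_right g_bracket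
        bracket_minus_left bracket_minus_right f)
qed

text \<open>The Leibniz-type identity above lets the two nilpotency exponents be lowered alternately,
  so that no binomial expansion is needed.\<close>
lemma eig_bracket:
  assumes A: "c \<in> A" "d \<in> A" and "x \<in> eig c" "y \<in> eig d"
  shows "x \<otimes> y \<in> eig (c * d)"
proof -
  have cd: "c * d \<in> A" using A by auto
  have "x \<otimes> y \<in> eig (c * d)"
    if "x \<in> carrier M" "y \<in> carrier M" "act (lin c ^ n) x = \<zero>" "act (lin d ^ m) y = \<zero>" for n m x y
    using that
  proof (induction "n + m" arbitrary: n m x y rule: less_induct)
    case less
    note [simp] = less.prems(1,2) A
    show ?case
    proof (cases "n = 0 \<or> m = 0")
      case True
      then have "x = \<zero> \<or> y = \<zero>" using less.prems by auto
      then show ?thesis using cd by auto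
    next
      case False
      then obtain n' m' where n: "n = Suc n'" "m = Suc m'" by (metis not0_implies_Suc)
      have "act (lin c) x \<otimes> g y \<in> eig (c * d)"
        using less.prems n by (intro less.hyps[of n' m])
          (simp_all add: act_g act_power_Suc del: power_Suc)
      moreover have "s c x \<otimes> act (lin d) y \<in> eig (c * d)"
        using less.prems n by (intro less.hyps[of n m'])
          (simp_all add: act_s act_power_Suc del: power_Suc)
      ultimately have "act (lin (c * d)) (x \<otimes> y) \<in> eig (c * d)"
        using cd by (simp add: act_linear_bracket eig_add)
      from eig_linearD[OF cd _ this] show ?thesis by simp
    qed
  qed
  then show ?thesis using assms by (auto simp: eig_def)
qed

text \<open>The Bezout relation of two linear factors. As soon as \<open>d - c\<close> is invertible
  in \<open>A\<close>, it drives both the disjointness of eigenspaces and the decomposition into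
  them.\<close>

lemma act_linear_diff:
  assumes [simp]: "c \<in> A" "d \<in> A" "x \<in> carrier M"
  shows "s (d - c) x = act (lin c) x \<oplus> s (- 1) (act (lin d) x)"
proof -
  have "act (lin c) x \<oplus> s (- 1) (act (lin d) x) = act (lin c + smult (- 1) (lin d)) x"
    by (simp only: act_add_left act_smult coeffs_in_smult coeffs_in_lin assms
        one_in uminus_in)
  also have "lin c + smult (- 1) (lin d) = [:d - c:]" by (simp add: lin_def)
  finally show ?thesis by (simp add: act_pCons)
qed

text \<open>On the diagonal only membership in \<open>A\<close> is recorded, so the condition can be
  imposed on all pairs from a set at once.\<close>

definition unit_diff :: "complex \<Rightarrow> complex \<Rightarrow> bool" where
  "unit_diff c d \<longleftrightarrow> c \<in> A \<and> d \<in> A \<and> (c \<noteq> d \<longrightarrow> inverse (c - d) \<in> A)"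

lemma unit_diff_sym: "unit_diff c d \<Longrightarrow> unit_diff d c"
  unfolding unit_diff_def using uminus_in[of "inverse (c - d)"]
  by (metis inverse_minus_eq minus_diff_eq)

text \<open>Induction on the sum of the two exponents: \<open>act (lin c) x\<close> and
  \<open>act (lin d) x\<close> satisfy the same hypotheses with one exponent lowered, hence vanish,
  and their difference is the unit \<open>d - c\<close> times \<open>x\<close>.\<close>

lemma eig_disjoint:
  assumes ud: "unit_diff d c" and "c \<noteq> d" and "x \<in> eig c" "x \<in> eig d"
  shows "x = \<zero>"
proof -
  note [simp] = ud[unfolded unit_diff_def, THEN conjunct1]
    ud[unfolded unit_diff_def, THEN conjunct2, THEN conjunct1]
  have "x = \<zero>"
    if "x \<in> carrier M" "act (lin c ^ n) x = \<zero>" "act (lin d ^ m) x = \<zero>" for n m x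
    using that
  proof (induction "n + m" arbitrary: n m x rule: less_induct)
    case less
    note [simp] = less.prems(1)
    show ?case
    proof (cases "n = 0 \<or> m = 0")
      case True
      then show ?thesis using less.prems by auto
    next
      case False
      then obtain n' m' where n: "n = Suc n'" "m = Suc m'" by (metis not0_implies_Suc)
      have c: "act (lin c ^ n) (act (lin d) x) = \<zero>"
        using less.prems(2) by (simp add: act_commute[of _ "lin d"])
      have d: "act (lin d ^ m) (act (lin c) x) = \<zero>"
        using less.prems(3) by (simp add: act_commute[of _ "lin c"])
      have "act (lin c) x = \<zero>"
        by (rule less.hyps[of n' m])
          (use less.prems(2) n d in \<open>simp_all add: act_power_Suc del: power_Suc\<close>)
      moreover have "act (lin d) x = \<zero>"
        by (rule less.hyps[of n m'])
          (use less.prems(3) n c in \<open>simp_all add: act_power_Suc del: power_Suc\<close>)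
      ultimately have "s (d - c) x = \<zero>" by (simp add: act_linear_diff)
      then show ?thesis
        using s_inverse_cancel[of "d - c" x] ud \<open>c \<noteq> d\<close> by (auto simp: unit_diff_def)
    qed
  qed
  then show ?thesis using assms(3,4) by (auto simp: eig_def)
qed

lemma act_finsum: "coeffs_in A p \<Longrightarrow> f \<in> I \<rightarrow> carrier M \<Longrightarrow>
    act p (finsum M f I) = (\<Oplus>i\<in>I. act p (f i))"
  by (rule additive_finsum[OF abelian_group_axioms abelian_group_axioms]) (auto simp: act_add_right)

text \<open>A power of \<open>lin d\<close> kills the summand at \<open>d\<close>; the images of the
  others form a vanishing sum over the smaller set, so each is zero. Then \<open>f c\<close> lies in
  the eigenspaces of both \<open>c\<close> and \<open>d\<close>, and \<open>eig_disjoint\<close>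
  applies.\<close>

lemma eig_independent:
  assumes "finite R" "\<And>c d. c \<in> R \<Longrightarrow> d \<in> R \<Longrightarrow> unit_diff c d"
    and "\<And>c. c \<in> R \<Longrightarrow> f c \<in> eig c" "(\<Oplus>c\<in>R. f c) = \<zero>" "c \<in> R"
  shows "f c = \<zero>"
  using assms
proof (induction R arbitrary: f c rule: finite_induct)
  case (insert d R)
  have dA: "d \<in> A" using insert.prems(1)[of d d] by (simp add: unit_diff_def)
  have RA: "c \<in> A" if "c \<in> R" for c using insert.prems(1)[of c c] that by (simp add: unit_diff_def)
  have fM: "f c \<in> carrier M" if "c \<in> insert d R" for c using insert.prems(2) that eig_carrier by auto
  obtain n where n: "act (lin d ^ n) (f d) = \<zero>" using insert.prems(2)[of d] by (auto simp: eig_def)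
  let ?p = "lin d ^ n"
  have p: "coeffs_in A ?p" using dA by simp
  have "f d \<oplus> (\<Oplus>c\<in>R. f c) = \<zero>" using insert.prems(3) insert.hyps fM by (simp add: Pi_iff)
  then have "act ?p (f d \<oplus> (\<Oplus>c\<in>R. f c)) = \<zero>" using p by simp
  then have "(\<Oplus>c\<in>R. act ?p (f c)) = \<zero>"
    using fM p n dA by (simp add: act_add_right act_finsum Pi_iff)
  then have z: "act ?p (f c) = \<zero>" if "c \<in> R" for c
    using insert.IH[of "\<lambda>c. act ?p (f c)" c] insert.prems that RA p eig_act by auto
  have R0: "f c = \<zero>" if "c \<in> R" for c
  proof (rule eig_disjoint[of d c])
    show "unit_diff d c" "c \<noteq> d" "f c \<in> eig c" using insert that by auto
    show "f c \<in> eig d" using z[OF that] fM that unfolding eig_def by blast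
  qed
  have "(\<Oplus>c\<in>R. f c) = \<zero>" using R0 by (simp add: add.finprod_one_eqI)
  then have "f d = \<zero>" using \<open>f d \<oplus> (\<Oplus>c\<in>R. f c) = \<zero>\<close> fM by simp
  then show ?case using R0 insert.prems(4) by auto
qed simp

text \<open>Induction on the total exponent. If two distinct \<open>c\<close>, \<open>d\<close> have
  positive exponents, then \<open>act (lin c) v\<close> and \<open>act (lin d) v\<close> are killed
  by products with one factor fewer, and dividing the difference of their decompositions by
  \<open>d - c\<close> decomposes \<open>v\<close>.\<close>

lemma eig_decompose:
  assumes "finite R" "\<And>c d. c \<in> R \<Longrightarrow> d \<in> R \<Longrightarrow> unit_diff c d"
    and "v \<in> carrier M" "act (\<Prod>c\<in>R. lin c ^ n c) v = \<zero>"
  shows "\<exists>f. (\<forall>c\<in>R. f c \<in> eig c) \<and> v = (\<Oplus>c\<in>R. f c)"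
  using assms(3,4)
proof (induction "\<Sum>c\<in>R. n c" arbitrary: n v rule: less_induct)
  case less
  note [simp] = assms(1) less.prems(1)
  have RA[simp]: "c \<in> A" if "c \<in> R" for c using assms(2)[of c c] that by (simp add: unit_diff_def)
  show ?case
  proof (cases "\<exists>c\<in>R. \<exists>d\<in>R. c \<noteq> d \<and> n c \<noteq> 0 \<and> n d \<noteq> 0")
    case True
    then obtain c d where cd: "c \<in> R" "d \<in> R" "c \<noteq> d" "n c \<noteq> 0" "n d \<noteq> 0" by auto
    have step: "\<exists>f. (\<forall>c\<in>R. f c \<in> eig c) \<and> act (lin e) v = (\<Oplus>c\<in>R. f c)"
      if "e \<in> R" "n e \<noteq> 0" for e
    proof -
      let ?n = "n(e := n e - 1)"
      have 1: "(\<Sum>c\<in>R. ?n c) < (\<Sum>c\<in>R. n c)"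
        by (rule sum_strict_mono_ex1) (use that in auto)
      have e: "lin e ^ n e = lin e ^ (n e - 1) * lin e"
        using that by (simp flip: power_Suc2)
      have "(\<Prod>c\<in>R. lin c ^ n c) = lin e ^ n e * (\<Prod>c\<in>R - {e}. lin c ^ n c)"
        using that by (subst prod.remove[of R e]) auto
      also have "\<dots> = (lin e ^ ?n e * (\<Prod>c\<in>R - {e}. lin c ^ ?n c)) * lin e"
        unfolding e by (simp add: mult_ac)
      also have "lin e ^ ?n e * (\<Prod>c\<in>R - {e}. lin c ^ ?n c) = (\<Prod>c\<in>R. lin c ^ ?n c)"
        using that by (subst prod.remove[of R e]) auto
      finally have 2: "act (\<Prod>c\<in>R. lin c ^ ?n c) (act (lin e) v) = \<zero>"
        using less.prems(2) that by (subst act_mult[symmetric]) (auto intro!: coeffs_in_prod)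
      show ?thesis using that by (intro less.hyps[OF 1 _ 2] act_closed coeffs_in_lin) simp_all
    qed
    from step[OF cd(1,4)] obtain f
      where f: "\<forall>c\<in>R. f c \<in> eig c" "act (lin c) v = (\<Oplus>c\<in>R. f c)" by (elim exE conjE)
    from step[OF cd(2,5)] obtain h
      where h: "\<forall>c\<in>R. h c \<in> eig c" "act (lin d) v = (\<Oplus>c\<in>R. h c)" by (elim exE conjE)
    note fh = f(1)[rule_format] f(2) h(1)[rule_format] h(2)
    have fhM: "f \<in> R \<rightarrow> carrier M" "h \<in> R \<rightarrow> carrier M"
      using fh(1,3)[THEN eig_carrier] by (simp_all add: Pi_iff)
    define i where "i = inverse (d - c)"
    have i: "i \<in> A" "i * (d - c) = 1" using assms(2)[of d c] cd by (auto simp: i_def unit_diff_def)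
    define k where "k e = s i (f e \<oplus> s (- 1) (h e))" for e
    have sfin: "s a (\<Oplus>c\<in>R. q c) = (\<Oplus>c\<in>R. s a (q c))" if "a \<in> A" "q \<in> R \<rightarrow> carrier M" for a q
      by (rule additive_finsum[OF abelian_group_axioms abelian_group_axioms])
        (use that in \<open>auto simp: s_add_right\<close>)
    have hM: "(\<lambda>c. s (- 1) (h c)) \<in> R \<rightarrow> carrier M"
      using fhM by (auto simp: Pi_iff)
    have "v = s i (s (d - c) v)" using i cd by (simp flip: s_mult)
    also have "\<dots> = s i ((\<Oplus>c\<in>R. f c) \<oplus> s (- 1) (\<Oplus>c\<in>R. h c))"
      using cd by (simp add: act_linear_diff fh)
    also have "s (- 1) (\<Oplus>c\<in>R. h c) = (\<Oplus>c\<in>R. s (- 1) (h c))"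
      using fhM by (simp add: sfin)
    also have "(\<Oplus>c\<in>R. f c) \<oplus> (\<Oplus>c\<in>R. s (- 1) (h c)) = (\<Oplus>c\<in>R. f c \<oplus> s (- 1) (h c))"
      using fhM hM by (simp add: finsum_addf)
    also have "s i \<dots> = (\<Oplus>c\<in>R. k c)"
      unfolding k_def using fhM hM i by (subst sfin) (auto simp: Pi_iff)
    finally have "v = (\<Oplus>c\<in>R. k c)" .
    moreover have "\<forall>c\<in>R. k c \<in> eig c" unfolding k_def using fh i by (auto intro!: eig_s eig_add)
    ultimately show ?thesis by (intro exI[of _ k] conjI) simp_all
  next
    \<comment> \<open>At most one exponent is positive here, so \<open>v\<close> lies in a single
      eigenspace, or is zero when all exponents vanish.\<close>
    case False
    show ?thesis
    proof (cases "\<exists>c\<in>R. n c \<noteq> 0")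
      case True
      then obtain c where c: "c \<in> R" "n c \<noteq> 0" by auto
      then have o: "\<And>d. d \<in> R \<Longrightarrow> d \<noteq> c \<Longrightarrow> n d = 0" using False by blast
      have "(\<Prod>d\<in>R. lin d ^ n d) = lin c ^ n c * (\<Prod>d\<in>R - {c}. lin d ^ n d)"
        using c by (subst prod.remove[of R c]) auto
      also have "(\<Prod>d\<in>R - {c}. lin d ^ n d) = 1" using o by (intro prod.neutral) auto
      finally have "v \<in> eig c" using less.prems by (auto simp: eig_def)
      then have "(\<forall>d\<in>R. (if c = d then v else \<zero>) \<in> eig d) \<and>
          v = (\<Oplus>d\<in>R. if c = d then v else \<zero>)"
        using c finsum_singleton[of c R "\<lambda>_. v"] by auto
      then show ?thesis by (rule exI[of _ "\<lambda>d. if c = d then v else \<zero>"])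
    next
      case False
      then have "(\<Prod>d\<in>R. lin d ^ n d) = 1" by (intro prod.neutral) auto
      then have "v = \<zero>" using less.prems by simp
      then show ?thesis by (intro exI[of _ "\<lambda>_. \<zero>"] conjI ballI) simp_all
    qed
  qed
qed

text \<open>Decompose \<open>v\<close> over \<open>R\<close> and put \<open>\<ominus> v\<close> at
  the new index \<open>e\<close>: the extended family sums to zero, so independence over
  \<open>insert e R\<close> kills \<open>v\<close>.\<close>

lemma eig_trivial:
  assumes R: "finite R" "\<And>c d. c \<in> insert e R \<Longrightarrow> d \<in> insert e R \<Longrightarrow> unit_diff c d" "e \<notin> R"
    and "act (\<Prod>c\<in>R. lin c ^ n c) v = \<zero>" "v \<in> eig e"
  shows "v = \<zero>"
proof -
  have v[simp]: "v \<in> carrier M" using assms eig_carrier by auto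
  have e[simp]: "e \<in> A" using R(2)[of e e] by (simp add: unit_diff_def)
  obtain f where f: "\<forall>c\<in>R. f c \<in> eig c" "v = (\<Oplus>c\<in>R. f c)"
    using eig_decompose[of R v n] assms by auto
  define h where "h c = (if c = e then \<ominus> v else f c)" for c
  have hM: "h \<in> R \<rightarrow> carrier M" using f(1) eig_carrier v by (auto simp: h_def)
  have he: "h e = \<ominus> v" by (simp add: h_def)
  have "(\<Oplus>c\<in>R. h c) = (\<Oplus>c\<in>R. f c)"
    using R(3) f by (intro finsum_cong') (auto simp: h_def eig_carrier)
  then have sum0: "(\<Oplus>c\<in>insert e R. h c) = \<zero>"
    using R hM he f(2)[symmetric] by (simp add: l_neg)
  have "h c \<in> eig c" if "c \<in> insert e R" for c
    using that f assms(5) eig_minus by (auto simp: h_def)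
  then have "h e = \<zero>" using eig_independent[OF _ R(2) _ sum0] R(1) by blast
  then have "\<ominus> v = \<zero>" using he by (simp only:)
  then have "\<ominus> (\<ominus> v) = \<ominus> \<zero>" by (simp only:)
  then show ?thesis by simp
qed

theorem eig_grading:
  assumes R: "finite R" "\<And>c d. c \<in> R \<Longrightarrow> d \<in> R \<Longrightarrow> unit_diff c d"
    and RR: "\<And>b c d. b \<in> R \<Longrightarrow> c \<in> R \<Longrightarrow> d \<in> R \<Longrightarrow> unit_diff (b * c) d"
    and ann: "\<And>v. v \<in> carrier M \<Longrightarrow> act (\<Prod>c\<in>R. lin c ^ n c) v = \<zero>"
    and alg: "\<And>c. c \<in> R \<Longrightarrow> algebraic c"
  shows "alg_graded M (\<lambda>c. if c \<in> R then eig c else {\<zero>})"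
proof -
  let ?K = "\<lambda>c. if c \<in> R then eig c else {\<zero>}"
  have RA[simp]: "c \<in> A" if "c \<in> R" for c using R(2)[of c c] that by (simp add: unit_diff_def)
  have sub: "subgroup {\<zero>} (add_monoid M)"
    by (rule add.subgroupI) (auto simp flip: a_inv_def)
  have br: "x \<otimes> y \<in> ?K (c * d)" if "x \<in> ?K c" "y \<in> ?K d" for x y c d
  proof (cases "c \<in> R \<and> d \<in> R")
    case True
    then have e: "x \<otimes> y \<in> eig (c * d)" using that by (auto intro: eig_bracket)
    show ?thesis
    proof (cases "c * d \<in> R")
      case False
      have "x \<otimes> y = \<zero>"
      proof (rule eig_trivial[OF R(1) _ False _ e])
        have "unit_diff (c * d) (c * d)" using True by (simp add: unit_diff_def)
        then show "unit_diff a b" if "a \<in> insert (c * d) R" "b \<in> insert (c * d) R" for a b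
          using that R(2) RR[of c d] True unit_diff_sym[of "c * d"]
          by (elim insertE) simp_all
        show "act (\<Prod>c\<in>R. lin c ^ n c) (x \<otimes> y) = \<zero>"
          using e eig_carrier by (intro ann) auto
      qed
      then show ?thesis using False by simp
    qed (use e in simp)
  next
    case False
    then have "x \<otimes> y = \<zero>" using that eig_carrier by (auto split: if_splits)
    then show ?thesis by auto
  qed
  have dec: "\<exists>!f. (\<forall>c. algebraic c \<longrightarrow> f c \<in> ?K c) \<and> (\<forall>c. \<not> algebraic c \<longrightarrow> f c = \<zero>) \<and>
      finite {c. f c \<noteq> \<zero>} \<and> v = (\<Oplus>c\<in>{c. f c \<noteq> \<zero>}. f c)" (is "\<exists>!f. ?P f") if v: "v \<in> carrier M" for v
  proof -
    have P: "(\<forall>c. f c \<in> ?K c) \<and> v = (\<Oplus>c\<in>R. f c)" if "?P f" for f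
    proof -
      have K: "f c \<in> ?K c" for c
        using that alg by (cases "algebraic c") auto
      have KM: "f c \<in> carrier M" for c using K[of c] eig_carrier by (auto split: if_splits)
      have "c \<in> R" if "f c \<noteq> \<zero>" for c using K[of c] that by (cases "c \<in> R") simp_all
      then have "{c. f c \<noteq> \<zero>} \<subseteq> R" by blast
      then have "(\<Oplus>c\<in>{c. f c \<noteq> \<zero>}. f c) = (\<Oplus>c\<in>R. f c)"
        using KM R(1) by (intro add.finprod_mono_neutral_cong_left) auto
      then show ?thesis using that K by auto
    qed
    have P': "?P f" if K: "\<forall>c. f c \<in> ?K c" and v: "v = (\<Oplus>c\<in>R. f c)" for f
    proof -
      have KM: "f c \<in> carrier M" for c using K[rule_format, of c] eig_carrier by (auto split: if_splits)
      have "c \<in> R" if "f c \<noteq> \<zero>" for c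
        using K[rule_format, of c] that by (cases "c \<in> R") simp_all
      then have sub: "{c. f c \<noteq> \<zero>} \<subseteq> R" by blast
      then have "(\<Oplus>c\<in>{c. f c \<noteq> \<zero>}. f c) = (\<Oplus>c\<in>R. f c)"
        using KM R(1) by (intro add.finprod_mono_neutral_cong_left) auto
      then show ?thesis using K v sub R(1) alg finite_subset[OF sub] by auto
    qed
    obtain f where f: "\<forall>c\<in>R. f c \<in> eig c" "v = (\<Oplus>c\<in>R. f c)"
      using eig_decompose[OF R v ann[OF v]] by auto
    define f' where "f' c = (if c \<in> R then f c else \<zero>)" for c
    have "v = (\<Oplus>c\<in>R. f' c)"
      unfolding f(2) using f(1) eig_carrier by (intro finsum_cong') (auto simp: f'_def)
    then have "?P f'" using f(1) by (intro P') (auto simp: f'_def)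
    \<comment> \<open>Uniqueness is independence applied to the difference of the two
      families.\<close>
    moreover have "f1 = f2" if "?P f1" "?P f2" for f1 f2
    proof
      fix c
      note 1 = P[OF that(1)] and 2 = P[OF that(2)]
      have M: "f1 \<in> R \<rightarrow> carrier M" "f2 \<in> R \<rightarrow> carrier M" "(\<lambda>c. s (- 1) (f2 c)) \<in> R \<rightarrow> carrier M"
        using 1 2 eig_carrier by (auto split: if_splits simp: Pi_iff)
      have "(\<Oplus>c\<in>R. f1 c \<oplus> s (- 1) (f2 c)) = (\<Oplus>c\<in>R. f1 c) \<oplus> (\<Oplus>c\<in>R. s (- 1) (f2 c))"
        using M by (simp add: finsum_addf)
      also have "(\<Oplus>c\<in>R. s (- 1) (f2 c)) = s (- 1) (\<Oplus>c\<in>R. f2 c)"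
        by (rule additive_finsum[OF abelian_group_axioms abelian_group_axioms, symmetric])
          (use M in \<open>auto simp: s_add_right\<close>)
      finally have z: "(\<Oplus>c\<in>R. f1 c \<oplus> s (- 1) (f2 c)) = \<zero>"
        using v 1 2 by (simp add: s_minus_left r_neg)
      show "f1 c = f2 c"
      proof (cases "c \<in> R")
        case True
        have "f1 c \<oplus> s (- 1) (f2 c) = \<zero>"
          by (rule eig_independent[OF R(1) R(2) _ z True])
            (use 1 2 in \<open>auto intro!: eig_add eig_s split: if_splits\<close>)
        then have "f1 c \<oplus> \<ominus> f2 c = \<zero>" using M True by (simp add: s_minus_left Pi_iff)
        then have "\<ominus> (\<ominus> f2 c) = f1 c" using M True by (intro minus_equality) auto
        then show ?thesis using M True by (simp add: Pi_iff)
      next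
        case False
        then show ?thesis using 1[THEN conjunct1, rule_format, of c] 2[THEN conjunct1, rule_format, of c]
          by simp
      qed
    qed
    ultimately show ?thesis by blast
  qed
  show ?thesis
    unfolding alg_graded_def
  proof (intro conjI allI impI ballI)
    show "subgroup (?K c) (add_monoid M)" for c using eig_subgroup sub by simp
  qed (rule br, assumption+, rule dec, assumption)
qed

end

subsection \<open>Extension of scalars\<close>

lemma (in abelian_group) int_mult_closed [simp, intro]: "x \<in> carrier G \<Longrightarrow> [(n::int)] \<cdot> x \<in> carrier G"
  by (rule add.int_pow_closed)

lemma (in abelian_group) finsum_int_mult:
  "x \<in> carrier G \<Longrightarrow> (\<Oplus>i\<in>I. [(f i :: int)] \<cdot> x) = [sum f I] \<cdot> x"
proof (induction I rule: infinite_finite_induct)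
  case (insert i I)
  then show ?case by (simp add: add.int_pow_mult)
qed (simp_all add: add_pow_def)

lemma (in abelian_group) finsum_split:
  assumes "\<And>i. i \<in> I \<Longrightarrow> g i \<in> carrier G" "\<And>i. i \<in> I \<Longrightarrow> h i \<in> carrier G"
    and "\<And>i. i \<in> I \<Longrightarrow> f i = g i \<oplus> h i"
  shows "(\<Oplus>i\<in>I. f i) = (\<Oplus>i\<in>I. g i) \<oplus> (\<Oplus>i\<in>I. h i)"
proof -
  have "(\<Oplus>i\<in>I. f i) = (\<Oplus>i\<in>I. g i \<oplus> h i)"
    by (rule finsum_cong') (use assms in auto)
  then show ?thesis using assms by (simp add: finsum_addf Pi_iff)
qed

lemma (in abelian_group) int_mult_zero [simp]: "x \<in> carrier G \<Longrightarrow> [(0::int)] \<cdot> x = \<zero>"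
  by (simp add: add_pow_def)

lemma (in abelian_group) int_mult_add:
  "x \<in> carrier G \<Longrightarrow> y \<in> carrier G \<Longrightarrow> [(n::int)] \<cdot> (x \<oplus> y) = [n] \<cdot> x \<oplus> [n] \<cdot> y"
  by (rule add.int_pow_distrib)

lemma (in abelian_group) int_mult_mult:
  "x \<in> carrier G \<Longrightarrow> [(m::int)] \<cdot> ([(n::int)] \<cdot> x) = [(m * n)] \<cdot> x"
  by (simp add: add.int_pow_pow mult.commute)

text \<open>Serves the coordinate maps of \<open>L \<otimes> O\<close> and the map
  \<open>v \<mapsto> v/1\<close> into the localization. The induction carries closure in
  \<open>G\<close> along, since additivity of \<open>h\<close> is known only there.\<close>

lemma additive_horner:
  assumes "abelian_group G" "abelian_group H"
    and cl: "\<And>x. x \<in> carrier G \<Longrightarrow> h x \<in> carrier H"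
    and add: "\<And>x y. x \<in> carrier G \<Longrightarrow> y \<in> carrier G \<Longrightarrow> h (x \<oplus>\<^bsub>G\<^esub> y) = h x \<oplus>\<^bsub>H\<^esub> h y"
    and g: "\<And>x. x \<in> carrier G \<Longrightarrow> g x \<in> carrier G"
    and gg': "\<And>x. x \<in> carrier G \<Longrightarrow> h (g x) = g' (h x)"
    and v: "v \<in> carrier G"
  shows "h (horner G g r v) = horner H g' r (h v)"
proof -
  interpret G: abelian_group G by fact
  have "foldr (\<lambda>c w. [c] \<cdot>\<^bsub>G\<^esub> v \<oplus>\<^bsub>G\<^esub> g w) cs \<zero>\<^bsub>G\<^esub> \<in> carrier G \<and>
    h (foldr (\<lambda>c w. [c] \<cdot>\<^bsub>G\<^esub> v \<oplus>\<^bsub>G\<^esub> g w) cs \<zero>\<^bsub>G\<^esub>) =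
    foldr (\<lambda>c w. [c] \<cdot>\<^bsub>H\<^esub> (h v) \<oplus>\<^bsub>H\<^esub> g' w) cs \<zero>\<^bsub>H\<^esub>" for cs :: "int list"
  proof (induction cs)
    case (Cons c cs)
    then show ?case
      using additive_int_mult[OF assms(1,2) cl add v, of c] by (simp add: add g gg' v)
  qed (simp add: additive_zero[OF assms(1,2) cl add])
  then show ?thesis by (simp add: horner_def)
qed

text \<open>Makes \<complex> a module over \<int>, so that \<open>Z.span\<close>,
  \<open>Z.independent\<close> and \<open>Z.representation\<close> speak about additive subgroups of
  \<complex>.\<close>

definition zscale :: "int \<Rightarrow> complex \<Rightarrow> complex" where
  "zscale n x = of_int n * x"

interpretation Z: module zscale
  by unfold_locales (auto simp: zscale_def algebra_simps)

text \<open>\<open>Z.span B\<close> is the ring \<open>O\<close>. The unit lies in the span but may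
  fail to be a basis element.\<close>

locale scalar_extension = Lie_ring L for L (structure) +
  fixes B :: "complex set"
  assumes finite_B [simp]: "finite B"
    and indep: "Z.independent B"
    and one_span: "1 \<in> Z.span B"
    and mult_span: "x \<in> Z.span B \<Longrightarrow> y \<in> Z.span B \<Longrightarrow> x * y \<in> Z.span B"
begin

sublocale subring_c "Z.span B"
  by unfold_locales (auto simp: one_span mult_span Z.span_diff)

abbreviation co :: "complex \<Rightarrow> complex \<Rightarrow> int" where
  "co \<equiv> Z.representation B"

lemma B_span [simp]: "b \<in> B \<Longrightarrow> b \<in> Z.span B"
  by (rule Z.span_base)

lemma co_add: "c \<in> Z.span B \<Longrightarrow> d \<in> Z.span B \<Longrightarrow> co (c + d) b = co c b + co d b"
  by (simp add: Z.representation_add indep)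

lemma co_basis: "b \<in> B \<Longrightarrow> co b x = (if x = b then 1 else 0)"
  by (simp add: Z.representation_basis indep)

text \<open>Expand \<open>d\<close> in the basis and multiply by \<open>c\<close>: the numbers
  \<open>co (c * x) b\<close> form the matrix of multiplication by \<open>c\<close>.\<close>

lemma co_mult:
  assumes "c \<in> Z.span B" "d \<in> Z.span B"
  shows "(\<Sum>x\<in>B. co d x * co (c * x) b) = co (c * d) b"
proof -
  have "d = (\<Sum>x\<in>B. zscale (co d x) x)"
    using Z.sum_representation_eq[OF indep assms(2) finite_B] by simp
  then have "c * d = c * (\<Sum>x\<in>B. zscale (co d x) x)" by (rule arg_cong)
  also have "\<dots> = (\<Sum>x\<in>B. zscale (co d x) (c * x))"
    by (simp add: sum_distrib_left zscale_def mult.left_commute)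
  finally have "co (c * d) b = co (\<Sum>x\<in>B. zscale (co d x) (c * x)) b" by (rule arg_cong)
  also have "\<dots> = (\<Sum>x\<in>B. co (zscale (co d x) (c * x)) b)"
    using assms by (subst Z.representation_sum) (auto simp: indep intro!: Z.span_scale)
  also have "\<dots> = (\<Sum>x\<in>B. co d x * co (c * x) b)"
    using assms by (intro sum.cong refl) (simp add: Z.representation_scale indep)
  finally show ?thesis by simp
qed

text \<open>The numbers \<open>co (x * y) b\<close> are the structure constants of \<open>O\<close>;
  summing over one factor after the other reduces this to \<open>co_mult\<close>.\<close>

lemma co_mult2:
  assumes "c \<in> Z.span B" "d \<in> Z.span B"
  shows "(\<Sum>p\<in>B \<times> B. co (fst p * snd p) b * (co c (fst p) * co d (snd p))) = co (c * d) b"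
proof -
  have "(\<Sum>p\<in>B \<times> B. co (fst p * snd p) b * (co c (fst p) * co d (snd p))) =
      (\<Sum>x\<in>B. \<Sum>y\<in>B. co (x * y) b * (co c x * co d y))"
    by (simp add: sum.cartesian_product case_prod_beta)
  also have "\<dots> = (\<Sum>x\<in>B. co c x * (\<Sum>y\<in>B. co d y * co (x * y) b))"
    by (simp add: sum_distrib_left mult_ac)
  also have "\<dots> = (\<Sum>x\<in>B. co c x * co (d * x) b)"
    using assms by (intro sum.cong refl) (simp add: co_mult mult.commute[of d])
  also have "\<dots> = co (d * c) b" using assms by (rule co_mult[rotated])
  finally show ?thesis by (simp add: mult.commute)
qed

text \<open>A family \<open>v\<close> stands for the sum of \<open>v b \<otimes> b\<close> over the
  basis, and the bracket is expanded with the structure constants of \<open>O\<close>. Functions are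
  extensional so that equality can be tested on coordinates.\<close>

definition T :: "(complex \<Rightarrow> 'a) ring" where
  "T = \<lparr>carrier = B \<rightarrow>\<^sub>E carrier L,
        monoid.mult = (\<lambda>v w. \<lambda>b\<in>B. \<Oplus>p\<in>B \<times> B. [co (fst p * snd p) b] \<cdot> (v (fst p) \<otimes> w (snd p))),
        monoid.one = (\<lambda>b\<in>B. \<zero>),
        ring.zero = (\<lambda>b\<in>B. \<zero>),
        ring.add = (\<lambda>v w. \<lambda>b\<in>B. v b \<oplus> w b)\<rparr>"

text \<open>The matrix of multiplication by \<open>c\<close> applied to a coordinate family.\<close>

definition sc :: "complex \<Rightarrow> (complex \<Rightarrow> 'a) \<Rightarrow> complex \<Rightarrow> 'a" where
  "sc c v = (\<lambda>b\<in>B. \<Oplus>x\<in>B. [co (c * x) b] \<cdot> (v x))"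

text \<open>The pure tensor \<open>u \<otimes> c\<close>, for arbitrary \<open>c\<close> in the
  span.\<close>

definition tensor :: "complex \<Rightarrow> 'a \<Rightarrow> complex \<Rightarrow> 'a" where
  "tensor c u = (\<lambda>b\<in>B. [co c b] \<cdot> u)"

lemma T_carrier: "v \<in> carrier T \<longleftrightarrow> v \<in> extensional B \<and> (\<forall>b\<in>B. v b \<in> carrier L)"
  by (auto simp: T_def PiE_iff)

lemma T_eqI: "v \<in> carrier T \<Longrightarrow> w \<in> carrier T \<Longrightarrow> (\<And>b. b \<in> B \<Longrightarrow> v b = w b) \<Longrightarrow> v = w"
  by (rule extensionalityI[of _ B]) (auto simp: T_carrier)

lemma T_coord [simp]: "v \<in> carrier T \<Longrightarrow> b \<in> B \<Longrightarrow> v b \<in> carrier L"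
  by (simp add: T_carrier)

lemma add_coord [simp]: "b \<in> B \<Longrightarrow> (v \<oplus>\<^bsub>T\<^esub> w) b = v b \<oplus> w b"
  and zero_coord [simp]: "b \<in> B \<Longrightarrow> \<zero>\<^bsub>T\<^esub> b = \<zero>"
  and mult_coord: "b \<in> B \<Longrightarrow> (v \<otimes>\<^bsub>T\<^esub> w) b =
    (\<Oplus>p\<in>B \<times> B. [co (fst p * snd p) b] \<cdot> (v (fst p) \<otimes> w (snd p)))"
  by (simp_all add: T_def)

lemma sc_coord: "b \<in> B \<Longrightarrow> sc c v b = (\<Oplus>x\<in>B. [co (c * x) b] \<cdot> (v x))"
  and tensor_coord [simp]: "b \<in> B \<Longrightarrow> tensor c u b = [co c b] \<cdot> u"
  by (simp_all add: sc_def tensor_def)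

lemma T_add_closed [simp, intro]: "v \<in> carrier T \<Longrightarrow> w \<in> carrier T \<Longrightarrow> v \<oplus>\<^bsub>T\<^esub> w \<in> carrier T"
  and T_zero_closed [simp, intro]: "\<zero>\<^bsub>T\<^esub> \<in> carrier T"
  and T_mult_closed [simp, intro]: "v \<in> carrier T \<Longrightarrow> w \<in> carrier T \<Longrightarrow> v \<otimes>\<^bsub>T\<^esub> w \<in> carrier T"
  and sc_closed [simp, intro]: "v \<in> carrier T \<Longrightarrow> sc c v \<in> carrier T"
  and tensor_closed [simp, intro]: "u \<in> carrier L \<Longrightarrow> tensor c u \<in> carrier T"
  by (auto simp: T_def sc_def tensor_def PiE_iff intro!: finsum_closed)

lemma T_abelian_group: "abelian_group T"
proof (rule abelian_groupI)
  fix v assume v: "v \<in> carrier T"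
  then have m: "(\<lambda>b\<in>B. \<ominus> v b) \<in> carrier T" by (auto simp: T_carrier)
  have "(\<lambda>b\<in>B. \<ominus> v b) \<oplus>\<^bsub>T\<^esub> v = \<zero>\<^bsub>T\<^esub>"
    using v m by (intro T_eqI T_add_closed T_zero_closed) (simp_all add: l_neg)
  then show "\<exists>y\<in>carrier T. y \<oplus>\<^bsub>T\<^esub> v = \<zero>\<^bsub>T\<^esub>" using m by blast
qed (auto intro!: T_eqI simp: a_ac)

sublocale T: abelian_group T
  by (rule T_abelian_group)

lemma mult_add_left:
  assumes "v \<in> carrier T" "w \<in> carrier T" "u \<in> carrier T"
  shows "(v \<oplus>\<^bsub>T\<^esub> w) \<otimes>\<^bsub>T\<^esub> u = (v \<otimes>\<^bsub>T\<^esub> u) \<oplus>\<^bsub>T\<^esub> (w \<otimes>\<^bsub>T\<^esub> u)"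
proof (rule T_eqI)
  fix b assume "b \<in> B"
  then show "((v \<oplus>\<^bsub>T\<^esub> w) \<otimes>\<^bsub>T\<^esub> u) b = ((v \<otimes>\<^bsub>T\<^esub> u) \<oplus>\<^bsub>T\<^esub> (w \<otimes>\<^bsub>T\<^esub> u)) b"
    unfolding add_coord[OF \<open>b \<in> B\<close>] mult_coord[OF \<open>b \<in> B\<close>]
    by (intro finsum_split) (use assms in \<open>auto simp: int_mult_add bracket_add_left\<close>)
qed (use assms in auto)

lemma mult_add_right:
  assumes "v \<in> carrier T" "w \<in> carrier T" "u \<in> carrier T"
  shows "u \<otimes>\<^bsub>T\<^esub> (v \<oplus>\<^bsub>T\<^esub> w) = (u \<otimes>\<^bsub>T\<^esub> v) \<oplus>\<^bsub>T\<^esub> (u \<otimes>\<^bsub>T\<^esub> w)"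
proof (rule T_eqI)
  fix b assume "b \<in> B"
  then show "(u \<otimes>\<^bsub>T\<^esub> (v \<oplus>\<^bsub>T\<^esub> w)) b = ((u \<otimes>\<^bsub>T\<^esub> v) \<oplus>\<^bsub>T\<^esub> (u \<otimes>\<^bsub>T\<^esub> w)) b"
    unfolding add_coord[OF \<open>b \<in> B\<close>] mult_coord[OF \<open>b \<in> B\<close>]
    by (intro finsum_split) (use assms in \<open>auto simp: int_mult_add bracket_add_right\<close>)
qed (use assms in auto)

lemma sc_add_right:
  assumes "v \<in> carrier T" "w \<in> carrier T"
  shows "sc c (v \<oplus>\<^bsub>T\<^esub> w) = sc c v \<oplus>\<^bsub>T\<^esub> sc c w"
proof (rule T_eqI)
  fix b assume "b \<in> B"
  then show "sc c (v \<oplus>\<^bsub>T\<^esub> w) b = (sc c v \<oplus>\<^bsub>T\<^esub> sc c w) b"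
    unfolding add_coord[OF \<open>b \<in> B\<close>] sc_coord[OF \<open>b \<in> B\<close>]
    by (intro finsum_split) (use assms in \<open>auto simp: int_mult_add\<close>)
qed (use assms in auto)

lemma sc_add_left:
  assumes "c \<in> Z.span B" "d \<in> Z.span B" "v \<in> carrier T"
  shows "sc (c + d) v = sc c v \<oplus>\<^bsub>T\<^esub> sc d v"
proof (rule T_eqI)
  fix b assume "b \<in> B"
  then show "sc (c + d) v b = (sc c v \<oplus>\<^bsub>T\<^esub> sc d v) b"
    unfolding add_coord[OF \<open>b \<in> B\<close>] sc_coord[OF \<open>b \<in> B\<close>]
    by (intro finsum_split)
      (use assms in \<open>auto simp: distrib_right co_add mult_span add.int_pow_mult\<close>)
qed (use assms in auto)

section \<open>Pure tensors and reduction of identities to them\<close>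

lemma mult_tensor:
  assumes "c \<in> Z.span B" "d \<in> Z.span B" "u \<in> carrier L" "w \<in> carrier L"
  shows "tensor c u \<otimes>\<^bsub>T\<^esub> tensor d w = tensor (c * d) (u \<otimes> w)"
proof (rule T_eqI)
  fix b assume b: "b \<in> B"
  have "(tensor c u \<otimes>\<^bsub>T\<^esub> tensor d w) b =
      (\<Oplus>p\<in>B \<times> B. [(co (fst p * snd p) b * (co c (fst p) * co d (snd p)))] \<cdot> (u \<otimes> w))"
    using b assms by (auto simp: mult_coord bracket_int_left bracket_int_right int_mult_mult Pi_iff
        mult_ac intro!: finsum_cong')
  then show "(tensor c u \<otimes>\<^bsub>T\<^esub> tensor d w) b = tensor (c * d) (u \<otimes> w) b"
    using b assms by (simp add: finsum_int_mult co_mult2)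
qed (use assms in auto)

lemma sc_tensor:
  assumes "c \<in> Z.span B" "d \<in> Z.span B" "u \<in> carrier L"
  shows "sc c (tensor d u) = tensor (c * d) u"
proof (rule T_eqI)
  fix b assume b: "b \<in> B"
  have "sc c (tensor d u) b = (\<Oplus>x\<in>B. [(co d x * co (c * x) b)] \<cdot> u)"
    using b assms by (auto simp: sc_coord int_mult_mult Pi_iff mult_ac intro!: finsum_cong')
  then show "sc c (tensor d u) b = tensor (c * d) u b"
    using b assms by (simp add: finsum_int_mult co_mult)
qed (use assms in auto)

text \<open>Pure tensors generate \<open>T\<close>: a vector is rebuilt from its truncations
  \<open>w S\<close>, where enlarging \<open>S\<close> by \<open>x\<close> adds the pure tensor
  \<open>tensor x (v x)\<close>.\<close>

lemma tensor_induct [consumes 1, case_names zero add]: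
  assumes "v \<in> carrier T" and zero: "P \<zero>\<^bsub>T\<^esub>"
    and add: "\<And>v c u. v \<in> carrier T \<Longrightarrow> P v \<Longrightarrow> c \<in> Z.span B \<Longrightarrow> u \<in> carrier L \<Longrightarrow>
      P (v \<oplus>\<^bsub>T\<^esub> tensor c u)"
  shows "P v"
proof -
  define w where "w S = (\<lambda>b\<in>B. if b \<in> S then v b else \<zero>)" for S
  have wT: "w S \<in> carrier T" for S using assms(1) by (auto simp: w_def T_carrier)
  have w: "w S b = (if b \<in> S then v b else \<zero>)" if "b \<in> B" for S b using that by (simp add: w_def)
  have "P (w S)" if "finite S" "S \<subseteq> B" for S
    using that
  proof (induction S rule: finite_induct)
    case empty
    have "w {} = \<zero>\<^bsub>T\<^esub>" using wT by (intro T_eqI) (auto simp: w)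
    then show ?case using zero by simp
  next
    case (insert x S)
    have "w (insert x S) = w S \<oplus>\<^bsub>T\<^esub> tensor x (v x)"
      using insert assms(1) wT by (intro T_eqI) (auto simp: w co_basis)
    then show ?case using add[OF wT[of S], of x "v x"] insert assms(1) by simp
  qed
  from this[OF finite_B order_refl] have "P (w B)" .
  also have "w B = v" using assms(1) wT by (intro T_eqI) (auto simp: w)
  finally show ?thesis .
qed

text \<open>Identities linear in an argument are thereby checked on pure tensors, where they split
  into an identity of \<open>L\<close> and one of the commutative ring \<open>O\<close>; structure
  constants disappear from view.\<close>

lemma additive_eqI:
  assumes H: "abelian_group H" and v: "v \<in> carrier T"
    and cl: "\<And>v. v \<in> carrier T \<Longrightarrow> f v \<in> carrier H" "\<And>v. v \<in> carrier T \<Longrightarrow> h v \<in> carrier H"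
    and add: "\<And>v w. v \<in> carrier T \<Longrightarrow> w \<in> carrier T \<Longrightarrow> f (v \<oplus>\<^bsub>T\<^esub> w) = f v \<oplus>\<^bsub>H\<^esub> f w"
      "\<And>v w. v \<in> carrier T \<Longrightarrow> w \<in> carrier T \<Longrightarrow> h (v \<oplus>\<^bsub>T\<^esub> w) = h v \<oplus>\<^bsub>H\<^esub> h w"
    and tens: "\<And>c u. c \<in> Z.span B \<Longrightarrow> u \<in> carrier L \<Longrightarrow> f (tensor c u) = h (tensor c u)"
  shows "f v = h v"
  using v
proof (induction rule: tensor_induct)
  case zero
  have "f \<zero>\<^bsub>T\<^esub> = \<zero>\<^bsub>H\<^esub>" by (rule additive_zero[OF T_abelian_group H, where h = f]) (fact cl add)+
  moreover have "h \<zero>\<^bsub>T\<^esub> = \<zero>\<^bsub>H\<^esub>" by (rule additive_zero[OF T_abelian_group H, where h = h]) (fact cl add)+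
  ultimately show ?case by simp
qed (simp add: add tens)

lemma tensor_add_right: "u \<in> carrier L \<Longrightarrow> w \<in> carrier L \<Longrightarrow>
    tensor c (u \<oplus> w) = tensor c u \<oplus>\<^bsub>T\<^esub> tensor c w"
  by (rule T_eqI) (auto simp: int_mult_add)

lemma tensor_zero [simp]: "tensor c \<zero> = \<zero>\<^bsub>T\<^esub>"
  by (rule T_eqI) auto

lemmas T_simps = mult_add_left mult_add_right T.a_ac

lemma T_antisym:
  assumes v: "v \<in> carrier T" and w: "w \<in> carrier T"
  shows "(v \<otimes>\<^bsub>T\<^esub> w) \<oplus>\<^bsub>T\<^esub> (w \<otimes>\<^bsub>T\<^esub> v) = \<zero>\<^bsub>T\<^esub>"
proof -
  have 1: "(v \<otimes>\<^bsub>T\<^esub> w) \<oplus>\<^bsub>T\<^esub> (w \<otimes>\<^bsub>T\<^esub> v) = \<zero>\<^bsub>T\<^esub>"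
    if v: "v \<in> carrier T" and w: "w = tensor d x" and d: "d \<in> Z.span B" "x \<in> carrier L" for v w d x
    using v
  proof (rule additive_eqI[OF T_abelian_group, where h = "\<lambda>_. \<zero>\<^bsub>T\<^esub>"], goal_cases)
    \<comment> \<open>The fifth goal is the check on pure tensors; the other four are closure and
      additivity of the two maps.\<close>
    case (5 c u)
    have "(u \<otimes> x) \<oplus> (x \<otimes> u) = \<zero>"
      using 5 d by (simp add: bracket_antisym[of u x] l_neg)
    then show ?case
      using 5 d w by (simp add: mult_tensor mult.commute[of d c] flip: tensor_add_right)
  qed (use w d in \<open>simp_all add: T_simps\<close>)
  show ?thesis
    using w
  proof (rule additive_eqI[OF T_abelian_group, where h = "\<lambda>_. \<zero>\<^bsub>T\<^esub>"], goal_cases)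
    case (5 c u)
    then show ?case using 1[OF v refl, of c u] by simp
  qed (use v in \<open>simp_all add: T_simps\<close>)
qed

text \<open>The square is not additive in \<open>v\<close>, so \<open>additive_eqI\<close> does not
  apply; adding a pure tensor instead creates cross terms that cancel by
  \<open>T_antisym\<close>.\<close>

lemma T_self: "v \<in> carrier T \<Longrightarrow> v \<otimes>\<^bsub>T\<^esub> v = \<zero>\<^bsub>T\<^esub>"
proof (induction rule: tensor_induct)
  case zero
  show ?case
    using additive_zero[OF T_abelian_group T_abelian_group, of "\<lambda>v. v \<otimes>\<^bsub>T\<^esub> \<zero>\<^bsub>T\<^esub>"]
    by (simp add: mult_add_left)
next
  case (add v c u)
  let ?t = "tensor c u"
  have "(v \<oplus>\<^bsub>T\<^esub> ?t) \<otimes>\<^bsub>T\<^esub> (v \<oplus>\<^bsub>T\<^esub> ?t) =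
      (v \<otimes>\<^bsub>T\<^esub> v \<oplus>\<^bsub>T\<^esub> ?t \<otimes>\<^bsub>T\<^esub> ?t) \<oplus>\<^bsub>T\<^esub> (v \<otimes>\<^bsub>T\<^esub> ?t \<oplus>\<^bsub>T\<^esub> ?t \<otimes>\<^bsub>T\<^esub> v)"
    using add by (simp add: T_simps)
  also have "?t \<otimes>\<^bsub>T\<^esub> ?t = \<zero>\<^bsub>T\<^esub>" using add by (simp add: mult_tensor)
  finally show ?case using add by (simp add: T_antisym)
qed

definition jac :: "(complex \<Rightarrow> 'a) \<Rightarrow> (complex \<Rightarrow> 'a) \<Rightarrow> (complex \<Rightarrow> 'a) \<Rightarrow> complex \<Rightarrow> 'a" where
  "jac x y z = (x \<otimes>\<^bsub>T\<^esub> (y \<otimes>\<^bsub>T\<^esub> z)) \<oplus>\<^bsub>T\<^esub> (y \<otimes>\<^bsub>T\<^esub> (z \<otimes>\<^bsub>T\<^esub> x)) \<oplus>\<^bsub>T\<^esub> (z \<otimes>\<^bsub>T\<^esub> (x \<otimes>\<^bsub>T\<^esub> y))"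

lemma jac_closed [simp]: "x \<in> carrier T \<Longrightarrow> y \<in> carrier T \<Longrightarrow> z \<in> carrier T \<Longrightarrow> jac x y z \<in> carrier T"
  by (simp add: jac_def)

lemma jac_rotate: "x \<in> carrier T \<Longrightarrow> y \<in> carrier T \<Longrightarrow> z \<in> carrier T \<Longrightarrow> jac x y z = jac y z x"
  by (simp add: jac_def T.a_ac)

lemma jac_add: "x \<in> carrier T \<Longrightarrow> x' \<in> carrier T \<Longrightarrow> y \<in> carrier T \<Longrightarrow> z \<in> carrier T \<Longrightarrow>
    jac (x \<oplus>\<^bsub>T\<^esub> x') y z = jac x y z \<oplus>\<^bsub>T\<^esub> jac x' y z"
  by (simp add: jac_def T_simps)

text \<open>By commutativity of \<open>O\<close> the three scalar factors coincide, and the Jacobi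
  sum of \<open>L\<close> factors out.\<close>

lemma jac_tensor:
  assumes "c \<in> Z.span B" "d \<in> Z.span B" "e \<in> Z.span B" "x \<in> carrier L" "y \<in> carrier L" "z \<in> carrier L"
  shows "jac (tensor c x) (tensor d y) (tensor e z) = \<zero>\<^bsub>T\<^esub>"
proof -
  have e: "d * (e * c) = c * (d * e)" "e * (c * d) = c * (d * e)" by simp_all
  have "jac (tensor c x) (tensor d y) (tensor e z) = tensor (c * (d * e)) (x \<otimes> (y \<otimes> z)) \<oplus>\<^bsub>T\<^esub>
      tensor (d * (e * c)) (y \<otimes> (z \<otimes> x)) \<oplus>\<^bsub>T\<^esub> tensor (e * (c * d)) (z \<otimes> (x \<otimes> y))"
    using assms by (simp add: jac_def mult_tensor mult_span)
  then show ?thesis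
    unfolding e using assms by (simp add: jacobi flip: tensor_add_right)
qed

text \<open>Vanishing on pure tensors is propagated to one argument at a time, rotating the arguments.\<close>
lemma jac_zero:
  assumes "x \<in> carrier T" "y \<in> carrier T" "z \<in> carrier T"
  shows "jac x y z = \<zero>\<^bsub>T\<^esub>"
proof -
  have ext: "jac x y z = \<zero>\<^bsub>T\<^esub>"
    if "x \<in> carrier T" "y \<in> carrier T" "z \<in> carrier T"
      "\<And>c u. c \<in> Z.span B \<Longrightarrow> u \<in> carrier L \<Longrightarrow> jac (tensor c u) y z = \<zero>\<^bsub>T\<^esub>" for x y z
    by (rule additive_eqI[OF T_abelian_group that(1), where h = "\<lambda>_. \<zero>\<^bsub>T\<^esub>"])
      (use that in \<open>simp_all add: jac_add\<close>)
  have 1: "jac x (tensor d u) (tensor e w) = \<zero>\<^bsub>T\<^esub>"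
    if "x \<in> carrier T" "d \<in> Z.span B" "u \<in> carrier L" "e \<in> Z.span B" "w \<in> carrier L" for x d u e w
    by (rule ext) (use that jac_tensor in auto)
  have 2: "jac x y (tensor e w) = \<zero>\<^bsub>T\<^esub>"
    if "x \<in> carrier T" "y \<in> carrier T" "e \<in> Z.span B" "w \<in> carrier L" for x y e w
  proof -
    have "jac y (tensor e w) x = \<zero>\<^bsub>T\<^esub>"
    proof (rule ext)
      fix d u assume "d \<in> Z.span B" "u \<in> carrier L"
      then show "jac (tensor d u) (tensor e w) x = \<zero>\<^bsub>T\<^esub>"
        using that 1[of x d u e w] jac_rotate[of x "tensor d u" "tensor e w"] by simp
    qed (use that in auto)
    then show ?thesis using that jac_rotate[of x y "tensor e w"] by simp
  qed
  have "jac z x y = \<zero>\<^bsub>T\<^esub>"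
  proof (rule ext)
    fix c u assume "c \<in> Z.span B" "u \<in> carrier L"
    then show "jac (tensor c u) x y = \<zero>\<^bsub>T\<^esub>"
      using assms 2[of x y c u] jac_rotate[of "tensor c u" x y] by simp
  qed (use assms in auto)
  then show ?thesis using assms jac_rotate[of z x y] by simp
qed

section \<open>The extended Lie algebra and its endomorphism\<close>

lemma T_lie_ring: "lie_ring T"
  unfolding lie_ring_def
  using T_abelian_group mult_add_left mult_add_right T_self jac_zero[unfolded jac_def] by auto

lemma T_Lie_algebra: "Lie_algebra (Z.span B) T sc"
proof
  show "lie_ring T" by (rule T_lie_ring)
  show "sc (c * d) v = sc c (sc d v)" if "c \<in> Z.span B" "d \<in> Z.span B" "v \<in> carrier T" for c d v
    by (rule additive_eqI[OF T_abelian_group that(3)])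
      (use that in \<open>auto simp: sc_add_right sc_tensor mult_span mult.assoc\<close>)
  show "sc 1 v = v" if "v \<in> carrier T" for v
    by (rule additive_eqI[OF T_abelian_group that])
      (use that in \<open>auto simp: sc_add_right sc_tensor\<close>)
  show "sc c (v \<otimes>\<^bsub>T\<^esub> w) = sc c v \<otimes>\<^bsub>T\<^esub> w"
    if c: "c \<in> Z.span B" and v: "v \<in> carrier T" and w: "w \<in> carrier T" for c v w
  proof (rule additive_eqI[OF T_abelian_group v])
    fix d u assume d: "d \<in> Z.span B" "u \<in> carrier L"
    show "sc c (tensor d u \<otimes>\<^bsub>T\<^esub> w) = sc c (tensor d u) \<otimes>\<^bsub>T\<^esub> w"
      by (rule additive_eqI[OF T_abelian_group w])
        (use c d in \<open>auto simp: mult_add_right sc_add_right sc_tensor mult_tensor mult_span mult.assoc\<close>)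
  qed (use c w in \<open>auto simp: mult_add_left sc_add_right\<close>)
qed (auto simp: sc_add_right sc_add_left)

definition lift :: "('a \<Rightarrow> 'a) \<Rightarrow> (complex \<Rightarrow> 'a) \<Rightarrow> complex \<Rightarrow> 'a" where
  "lift g v = (\<lambda>b\<in>B. g (v b))"

lemma lift_coord: "b \<in> B \<Longrightarrow> lift g v b = g (v b)"
  by (simp add: lift_def)

lemma T_endo:
  assumes g: "lie_endo L g"
  shows "Lie_algebra_endo (Z.span B) T sc (lift g)"
proof -
  have gcl: "x \<in> carrier L \<Longrightarrow> g x \<in> carrier L"
    and gadd: "x \<in> carrier L \<Longrightarrow> y \<in> carrier L \<Longrightarrow> g (x \<oplus> y) = g x \<oplus> g y"
    and gbr: "x \<in> carrier L \<Longrightarrow> y \<in> carrier L \<Longrightarrow> g (x \<otimes> y) = g x \<otimes> g y" for x y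
    using g unfolding lie_endo_def by blast+
  note gint = additive_int_mult[OF abelian_group_axioms abelian_group_axioms gcl gadd]
  have cl: "lift g v \<in> carrier T" if "v \<in> carrier T" for v
    using that gcl by (auto simp: lift_def T_carrier)
  have add: "lift g (v \<oplus>\<^bsub>T\<^esub> w) = lift g v \<oplus>\<^bsub>T\<^esub> lift g w" if "v \<in> carrier T" "w \<in> carrier T" for v w
    by (rule T_eqI) (use that cl in \<open>auto simp: lift_coord gadd\<close>)
  have lt: "lift g (tensor c u) = tensor c (g u)" if "u \<in> carrier L" for c u
    by (rule T_eqI) (use that cl gcl in \<open>auto simp: lift_coord gint\<close>)
  have br: "lift g (v \<otimes>\<^bsub>T\<^esub> w) = lift g v \<otimes>\<^bsub>T\<^esub> lift g w" if v: "v \<in> carrier T" and w: "w \<in> carrier T" for v w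
  proof (rule additive_eqI[OF T_abelian_group v])
    fix d u assume d: "d \<in> Z.span B" "u \<in> carrier L"
    show "lift g (tensor d u \<otimes>\<^bsub>T\<^esub> w) = lift g (tensor d u) \<otimes>\<^bsub>T\<^esub> lift g w"
      by (rule additive_eqI[OF T_abelian_group w])
        (use d in \<open>auto simp: mult_add_right lt mult_tensor add cl gcl gbr\<close>)
  qed (use w in \<open>auto simp: mult_add_left add cl\<close>)
  have ls: "lift g (sc c v) = sc c (lift g v)" if c: "c \<in> Z.span B" and v: "v \<in> carrier T" for c v
    by (rule additive_eqI[OF T_abelian_group v])
      (use c in \<open>auto simp: sc_add_right add cl lt sc_tensor gcl\<close>)
  interpret TA: Lie_algebra "Z.span B" T sc by (rule T_Lie_algebra)
  show ?thesis
    by unfold_locales (use cl add br ls in \<open>auto simp: lie_endo_def\<close>)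
qed

lemma T_int_mult_coord: "v \<in> carrier T \<Longrightarrow> b \<in> B \<Longrightarrow> ([(n::int)] \<cdot>\<^bsub>T\<^esub> v) b = [n] \<cdot> (v b)"
  by (rule additive_int_mult[OF T_abelian_group abelian_group_axioms, of "\<lambda>v. v b"]) auto

text \<open>Here freeness of \<open>O\<close> pays off: an integer acts on each coordinate
  separately.\<close>

lemma T_no_torsion:
  assumes "\<not> has_torsion L n"
  shows "\<not> has_torsion T n"
proof
  assume "has_torsion T n"
  then obtain v where v: "v \<in> carrier T" "v \<noteq> \<zero>\<^bsub>T\<^esub>" "[n] \<cdot>\<^bsub>T\<^esub> v = \<zero>\<^bsub>T\<^esub>"
    by (auto simp: has_torsion_def)
  have "v b = \<zero>" if "b \<in> B" for b
    using T_int_mult_coord[OF v(1) that, of n] v assms that by (auto simp: has_torsion_def)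
  then show False using v by (metis T_eqI T_zero_closed zero_coord)
qed

lemma T_horner:
  assumes g: "lie_endo L g" and ann: "\<And>u. u \<in> carrier L \<Longrightarrow> horner L g r u = \<zero>"
    and v: "v \<in> carrier T"
  shows "horner T (lift g) r v = \<zero>\<^bsub>T\<^esub>"
proof -
  interpret TE: Lie_algebra_endo "Z.span B" T sc "lift g" using g by (rule T_endo)
  have "horner T (lift g) r v b = \<zero>" if b: "b \<in> B" for b
  proof -
    have "horner T (lift g) r v b = horner L g r (v b)"
      by (rule additive_horner[OF T_abelian_group abelian_group_axioms, where h = "\<lambda>v. v b"])
        (use v b TE.g_closed in \<open>simp_all add: lift_coord\<close>)
    then show ?thesis using ann v b by simp
  qed
  moreover have "horner T (lift g) r v \<in> carrier T"
    using TE.act_closed[OF coeffs_in_of_int v, of r] TE.act_of_int[OF v, of r] by simp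
  ultimately show ?thesis by (intro T_eqI) auto
qed

text \<open>Since \<open>1\<close> may lie outside \<open>B\<close>, \<open>u\<close> need not occur
  among the coordinates of \<open>tensor 1 u\<close>. Multiplying by a basis element
  \<open>b\<close> gives \<open>tensor b u\<close>, whose coordinate at \<open>b\<close> is
  \<open>u\<close>.\<close>

lemma tensor_one_inj: "inj_on (tensor 1) (carrier L)"
proof (rule inj_onI)
  fix u w assume uw: "u \<in> carrier L" "w \<in> carrier L" "tensor 1 u = tensor 1 w"
  have "B \<noteq> {}"
  proof
    assume "B = {}"
    then have "(1::complex) \<in> Z.span {}" using one_span by (simp only:)
    then show False by (simp add: Z.span_empty)
  qed
  then obtain b where b: "b \<in> B" by auto
  have "tensor b u = sc b (tensor 1 u)" using uw(1) b by (simp add: sc_tensor)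
  also have "\<dots> = sc b (tensor 1 w)" by (simp only: uw(3))
  also have "\<dots> = tensor b w" using uw(2) b by (simp add: sc_tensor)
  finally have "tensor b u b = tensor b w b" by (rule arg_cong)
  then show "u = w" using uw b by (simp add: co_basis)
qed

end

subsection \<open>Localization\<close>

text \<open>Injectivity of \<open>N\<close> on \<open>M\<close> allows denominators to be cancelled.
  The map \<open>h\<close> injects pairs of a numerator and an exponent into the type
  \<open>'c\<close> on which the localization has to live.\<close>

locale localization = Lie_algebra_endo A M s g for A and M :: "('a, 'm) ring_scheme" (structure) and s g +
  fixes N :: complex and h :: "'a \<times> nat \<Rightarrow> 'c"
  assumes N_in [simp, intro]: "N \<in> A" and N_nz [simp]: "N \<noteq> 0"
    and N_cancel: "x \<in> carrier M \<Longrightarrow> s N x = \<zero> \<Longrightarrow> x = \<zero>"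
    and h_inj: "inj_on h (carrier M \<times> UNIV)"
begin

section \<open>Fractions with powers of \<open>N\<close> as denominators\<close>

definition pw :: "nat \<Rightarrow> 'a \<Rightarrow> 'a" where
  "pw k x = s (N ^ k) x"

lemma pw_closed [simp, intro]: "x \<in> carrier M \<Longrightarrow> pw k x \<in> carrier M"
  by (simp add: pw_def)

lemma pw_pw [simp]: "x \<in> carrier M \<Longrightarrow> pw k (pw l x) = pw (k + l) x"
  by (simp add: pw_def power_add s_mult)

lemma pw_0 [simp]: "x \<in> carrier M \<Longrightarrow> pw 0 x = x"
  by (simp add: pw_def)

lemma pw_add: "x \<in> carrier M \<Longrightarrow> y \<in> carrier M \<Longrightarrow> pw k (x \<oplus> y) = pw k x \<oplus> pw k y"
  by (simp add: pw_def s_add_right)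

lemma pw_bracket: "x \<in> carrier M \<Longrightarrow> y \<in> carrier M \<Longrightarrow> pw k x \<otimes> pw l y = pw (k + l) (x \<otimes> y)"
  by (simp add: pw_def power_add s_mult s_bracket_right[of "N ^ l"] s_bracket_left[of "N ^ k", symmetric])

lemma pw_g: "x \<in> carrier M \<Longrightarrow> pw k (g x) = g (pw k x)"
  by (simp add: pw_def g_s)

lemma pw_zero [simp]: "pw k \<zero> = \<zero>"
  by (simp add: pw_def)

lemma pw_eq_zeroD: "x \<in> carrier M \<Longrightarrow> pw k x = \<zero> \<Longrightarrow> x = \<zero>"
proof (induction k)
  case (Suc k)
  then have "s N (pw k x) = \<zero>" by (simp add: pw_def s_mult)
  then show ?case using Suc N_cancel[of "pw k x"] by simp
qed simp

lemma pw_cancel: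
  assumes "x \<in> carrier M" "y \<in> carrier M" "pw k x = pw k y"
  shows "x = y"
proof -
  have "pw k (x \<oplus> \<ominus> y) = \<zero>"
    using assms by (simp add: pw_add r_neg) (simp add: pw_def s_minus_right r_neg)
  from pw_eq_zeroD[OF _ this] have "x \<oplus> \<ominus> y = \<zero>" using assms(1,2) by simp
  then have "\<ominus> (\<ominus> y) = x" using assms(1,2) by (intro minus_equality) simp_all
  then show ?thesis using assms by simp
qed

lemma pw_shift: "x \<in> carrier M \<Longrightarrow> y \<in> carrier M \<Longrightarrow> pw i x = pw j y \<Longrightarrow> pw (k + i) x = pw (k + j) y"
  by (metis pw_pw)

text \<open>The fraction \<open>v / N^i\<close>. The predicate collects all pairs denoting the same
  fraction, and the code of one chosen pair stands for the whole class.\<close>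

definition cls :: "'a \<Rightarrow> nat \<Rightarrow> 'c" where
  "cls v i = h (SOME p. fst p \<in> carrier M \<and> pw i (fst p) = pw (snd p) v)"

text \<open>Equal codes yield, by injectivity of \<open>h\<close>, one pair representing both
  fractions, and its exponent cancels. Conversely, cross-multiplied equality makes the two
  predicates equivalent, so the choice returns the same pair.\<close>

lemma cls_eq:
  assumes v: "v \<in> carrier M" and w: "w \<in> carrier M"
  shows "cls v i = cls w j \<longleftrightarrow> pw j v = pw i w"
proof -
  let ?P = "\<lambda>v i p. fst p \<in> carrier M \<and> pw i (fst p) = pw (snd p) v"
  have ex: "?P v i (Eps (?P v i))" if "v \<in> carrier M" for v i
    by (rule someI[of "?P v i" "(v, i)"]) (use that in simp)
  show ?thesis
  proof
    assume "cls v i = cls w j"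
    then have eq: "Eps (?P v i) = Eps (?P w j)"
      using inj_onD[OF h_inj, of "Eps (?P v i)" "Eps (?P w j)"] ex[OF v, of i] ex[OF w, of j]
      by (auto simp: cls_def mem_Times_iff)
    obtain u k where u: "Eps (?P v i) = (u, k)" by (cases "Eps (?P v i)")
    have uM: "u \<in> carrier M" and 1: "pw i u = pw k v" and 2: "pw j u = pw k w"
      using ex[OF v, of i, unfolded u] ex[OF w, of j, folded eq, unfolded u] by simp_all
    have "pw (k + j) v = pw (k + i) w"
      using pw_shift[OF uM v 1, of j] pw_shift[OF uM w 2, of i] by (simp add: add.commute)
    with v w show "pw j v = pw i w" by (intro pw_cancel[of "pw j v" "pw i w" k]) simp_all
  next
    assume eq: "pw j v = pw i w"
    have "?P v i p \<longleftrightarrow> ?P w j p" for p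
    proof (cases p)
      case (Pair u k)
      have "pw i u = pw k v \<longleftrightarrow> pw j u = pw k w" if u: "u \<in> carrier M"
      proof
        assume "pw i u = pw k v"
        then have "pw (i + j) u = pw (i + k) w"
          using pw_shift[OF u v, of i k j] pw_shift[OF v w eq, of k] by (simp add: add.commute)
        with u w show "pw j u = pw k w" by (intro pw_cancel[of "pw j u" "pw k w" i]) simp_all
      next
        assume "pw j u = pw k w"
        then have "pw (j + i) u = pw (j + k) v"
          using pw_shift[OF u w, of j k i] pw_shift[OF v w eq, of k] by (simp add: add.commute)
        with u v show "pw i u = pw k v" by (intro pw_cancel[of "pw i u" "pw k v" j]) simp_all
      qed
      then show ?thesis using Pair by auto
    qed
    then show "cls v i = cls w j" by (simp add: cls_def)
  qed
qed

text \<open>Some fraction denoting \<open>x\<close>, possibly another than the one \<open>x\<close>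
  was formed from; \<open>rep_cls\<close> states how the two are related.\<close>

definition rep :: "'c \<Rightarrow> 'a \<times> nat" where
  "rep x = (SOME p. fst p \<in> carrier M \<and> x = cls (fst p) (snd p))"

lemma rep_cls:
  assumes "v \<in> carrier M"
  obtains w j where "rep (cls v i) = (w, j)" "w \<in> carrier M" "pw i w = pw j v"
proof -
  have "fst (rep (cls v i)) \<in> carrier M \<and> cls v i = cls (fst (rep (cls v i))) (snd (rep (cls v i)))"
    unfolding rep_def
    by (rule someI[of "\<lambda>p. fst p \<in> carrier M \<and> cls v i = cls (fst p) (snd p)" "(v, i)"])
      (use assms in simp)
  then show thesis
    using that[of "fst (rep (cls v i))" "snd (rep (cls v i))"] assms by (auto simp: cls_eq)
qed

definition F :: "'c ring" where
  "F = \<lparr>carrier = {cls v i |v i. v \<in> carrier M},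
        monoid.mult = (\<lambda>x y. cls (fst (rep x) \<otimes> fst (rep y)) (snd (rep x) + snd (rep y))),
        monoid.one = cls \<zero> 0,
        ring.zero = cls \<zero> 0,
        ring.add = (\<lambda>x y. cls (pw (snd (rep y)) (fst (rep x)) \<oplus> pw (snd (rep x)) (fst (rep y)))
          (snd (rep x) + snd (rep y)))\<rparr>"

definition frac :: "complex set" where
  "frac = {a / N ^ k |a k. a \<in> A}"

definition num :: "complex \<Rightarrow> complex \<times> nat" where
  "num c = (SOME p. fst p \<in> A \<and> c = fst p / N ^ snd p)"

definition fsc :: "complex \<Rightarrow> 'c \<Rightarrow> 'c" where
  "fsc c x = cls (s (fst (num c)) (fst (rep x))) (snd (rep x) + snd (num c))"

definition fg :: "'c \<Rightarrow> 'c" where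
  "fg x = cls (g (fst (rep x))) (snd (rep x))"

section \<open>Operations on fractions\<close>

lemma cls_closed [simp, intro]: "v \<in> carrier M \<Longrightarrow> cls v i \<in> carrier F"
  by (auto simp: F_def)

lemma F_cases:
  assumes "x \<in> carrier F"
  obtains v i where "v \<in> carrier M" "x = cls v i"
  using assms by (auto simp: F_def)

text \<open>A common denominator for three elements, so that the ring laws reduce through
  \<open>add_cls\<close> and \<open>mult_cls\<close> to those of \<open>M\<close>.\<close>

lemma F_cases3:
  assumes "x \<in> carrier F" "y \<in> carrier F" "z \<in> carrier F"
  obtains v w u i where "v \<in> carrier M" "w \<in> carrier M" "u \<in> carrier M"
    "x = cls v i" "y = cls w i" "z = cls u i"
proof -
  obtain v w u i j k where vwu: "v \<in> carrier M" "w \<in> carrier M" "u \<in> carrier M"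
    "x = cls v i" "y = cls w j" "z = cls u k"
    using assms by (metis F_cases)
  have "x = cls (pw (j + k) v) (i + j + k)" "y = cls (pw (i + k) w) (i + j + k)"
    "z = cls (pw (i + j) u) (i + j + k)"
    using vwu by (simp_all add: cls_eq add_ac)
  then show thesis using vwu that by blast
qed

lemma F_zero: "\<zero>\<^bsub>F\<^esub> = cls \<zero> i"
  by (simp add: F_def cls_eq)

lemma mult_cls:
  assumes v: "v \<in> carrier M" and w: "w \<in> carrier M"
  shows "cls v i \<otimes>\<^bsub>F\<^esub> cls w j = cls (v \<otimes> w) (i + j)"
proof -
  obtain v' i' where v': "rep (cls v i) = (v', i')" "v' \<in> carrier M" "pw i v' = pw i' v"
    using rep_cls[OF v] .
  obtain w' j' where w': "rep (cls w j) = (w', j')" "w' \<in> carrier M" "pw j w' = pw j' w"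
    using rep_cls[OF w] .
  have "pw (i + j) (v' \<otimes> w') = pw (i' + j') (v \<otimes> w)"
    using v w v'(2,3) w'(2,3) by (simp flip: pw_bracket)
  then show ?thesis using v w v' w' by (simp add: F_def cls_eq)
qed

lemma add_cls:
  assumes v: "v \<in> carrier M" and w: "w \<in> carrier M"
  shows "cls v i \<oplus>\<^bsub>F\<^esub> cls w i = cls (v \<oplus> w) i"
proof -
  obtain v' i' where v': "rep (cls v i) = (v', i')" "v' \<in> carrier M" "pw i v' = pw i' v"
    using rep_cls[OF v] .
  obtain w' j' where w': "rep (cls w i) = (w', j')" "w' \<in> carrier M" "pw i w' = pw j' w"
    using rep_cls[OF w] .
  have "pw (i + j') v' = pw (i' + j') v" "pw (i + i') w' = pw (i' + j') w"
    using pw_shift[OF v'(2) v v'(3), of j'] pw_shift[OF w'(2) w w'(3), of i'] by (simp_all add: add_ac)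
  then have "pw i (pw j' v' \<oplus> pw i' w') = pw (i' + j') (v \<oplus> w)"
    using v w v' w' by (simp add: pw_add)
  then show ?thesis using v w v' w' by (simp add: F_def cls_eq)
qed

lemma fg_cls:
  assumes v: "v \<in> carrier M"
  shows "fg (cls v i) = cls (g v) i"
proof -
  obtain v' i' where v': "rep (cls v i) = (v', i')" "v' \<in> carrier M" "pw i v' = pw i' v"
    using rep_cls[OF v] .
  then show ?thesis using v by (simp add: fg_def cls_eq pw_g)
qed

text \<open>Both the scalar and the element enter the definition through chosen representatives;
  cross multiplication shows that the choices do not matter.\<close>

lemma fsc_cls:
  assumes v: "v \<in> carrier M" and a: "a \<in> A"
  shows "fsc (a / N ^ k) (cls v i) = cls (s a v) (i + k)"
proof -
  obtain v' i' where v': "rep (cls v i) = (v', i')" "v' \<in> carrier M" "pw i v' = pw i' v"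
    using rep_cls[OF v] .
  have "fst (num (a / N ^ k)) \<in> A \<and> a / N ^ k = fst (num (a / N ^ k)) / N ^ snd (num (a / N ^ k))"
    unfolding num_def
    by (rule someI[of "\<lambda>p. fst p \<in> A \<and> a / N ^ k = fst p / N ^ snd p" "(a, k)"]) (use a in simp)
  then obtain a' k' where a': "num (a / N ^ k) = (a', k')" "a' \<in> A" "a / N ^ k = a' / N ^ k'"
    by (cases "num (a / N ^ k)") auto
  have e: "a' * N ^ k = a * N ^ k'" using a'(3) by (simp add: field_simps)
  have "pw (i + k) (s a' v') = s (a' * N ^ k) (pw i v')"
    using a'(2) v'(2) by (simp add: pw_def power_add mult_ac flip: s_mult)
  also have "\<dots> = s (a * N ^ k') (pw i' v)" by (simp add: e v')
  also have "\<dots> = pw (i' + k') (s a v)"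
    using a v by (simp add: pw_def power_add mult_ac flip: s_mult)
  finally show ?thesis using v v' a a' by (simp add: fsc_def cls_eq)
qed

lemma F_abelian_group: "abelian_group F"
proof (rule abelian_groupI)
  fix x y z assume "x \<in> carrier F" "y \<in> carrier F" "z \<in> carrier F"
  then show "x \<oplus>\<^bsub>F\<^esub> y \<oplus>\<^bsub>F\<^esub> z = x \<oplus>\<^bsub>F\<^esub> (y \<oplus>\<^bsub>F\<^esub> z)"
    by (rule F_cases3) (simp add: add_cls a_assoc)
next
  fix x y assume "x \<in> carrier F" "y \<in> carrier F"
  then obtain v w i where "v \<in> carrier M" "w \<in> carrier M" "x = cls v i" "y = cls w i"
    using F_cases3[of x y y] by metis
  then show "x \<oplus>\<^bsub>F\<^esub> y \<in> carrier F" "x \<oplus>\<^bsub>F\<^esub> y = y \<oplus>\<^bsub>F\<^esub> x"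
    by (simp_all add: add_cls a_comm)
next
  fix x assume x: "x \<in> carrier F"
  then obtain v i where v: "v \<in> carrier M" "x = cls v i" by (rule F_cases)
  then show "\<zero>\<^bsub>F\<^esub> \<oplus>\<^bsub>F\<^esub> x = x" by (simp add: F_zero[of i] add_cls)
  have "cls (\<ominus> v) i \<oplus>\<^bsub>F\<^esub> x = \<zero>\<^bsub>F\<^esub>" using v by (simp add: F_zero[of i] add_cls l_neg)
  then show "\<exists>y\<in>carrier F. y \<oplus>\<^bsub>F\<^esub> x = \<zero>\<^bsub>F\<^esub>" using v by (intro bexI[of _ "cls (\<ominus> v) i"]) auto
qed (simp add: F_zero[of 0])

lemma F_lie_ring: "lie_ring F"
  unfolding lie_ring_def
proof (intro conjI ballI)
  show "abelian_group F" by (rule F_abelian_group)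
next
  fix x y assume "x \<in> carrier F" "y \<in> carrier F"
  then obtain v w i where "v \<in> carrier M" "w \<in> carrier M" "x = cls v i" "y = cls w i"
    using F_cases3[of x y y] by metis
  then show "x \<otimes>\<^bsub>F\<^esub> y \<in> carrier F" by (simp add: mult_cls)
next
  fix x assume "x \<in> carrier F"
  then show "x \<otimes>\<^bsub>F\<^esub> x = \<zero>\<^bsub>F\<^esub>" by (rule F_cases) (simp add: mult_cls flip: F_zero)
next
  fix x y z assume "x \<in> carrier F" "y \<in> carrier F" "z \<in> carrier F"
  then obtain v w u i where *: "v \<in> carrier M" "w \<in> carrier M" "u \<in> carrier M"
    "x = cls v i" "y = cls w i" "z = cls u i" by (rule F_cases3)
  show "(x \<oplus>\<^bsub>F\<^esub> y) \<otimes>\<^bsub>F\<^esub> z = (x \<otimes>\<^bsub>F\<^esub> z) \<oplus>\<^bsub>F\<^esub> (y \<otimes>\<^bsub>F\<^esub> z)"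
    using * by (simp add: add_cls mult_cls bracket_add_left)
  show "z \<otimes>\<^bsub>F\<^esub> (x \<oplus>\<^bsub>F\<^esub> y) = (z \<otimes>\<^bsub>F\<^esub> x) \<oplus>\<^bsub>F\<^esub> (z \<otimes>\<^bsub>F\<^esub> y)"
    using * by (simp add: add_cls mult_cls bracket_add_right)
  show "(x \<otimes>\<^bsub>F\<^esub> (y \<otimes>\<^bsub>F\<^esub> z)) \<oplus>\<^bsub>F\<^esub> (y \<otimes>\<^bsub>F\<^esub> (z \<otimes>\<^bsub>F\<^esub> x)) \<oplus>\<^bsub>F\<^esub> (z \<otimes>\<^bsub>F\<^esub> (x \<otimes>\<^bsub>F\<^esub> y)) = \<zero>\<^bsub>F\<^esub>"
    using * by (simp add: add_cls mult_cls jacobi F_zero[of "i + (i + i)"])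
qed

lemma frac_cases2:
  assumes "c \<in> frac" "d \<in> frac"
  obtains a b k where "a \<in> A" "b \<in> A" "c = a / N ^ k" "d = b / N ^ k"
proof -
  obtain a b k l where *: "a \<in> A" "b \<in> A" "c = a / N ^ k" "d = b / N ^ l"
    using assms by (auto simp: frac_def)
  have "c = (a * N ^ l) / N ^ (k + l)" "d = (b * N ^ k) / N ^ (k + l)"
    using * by (simp_all add: power_add)
  then show thesis using that[of "a * N ^ l" "b * N ^ k" "k + l"] * by auto
qed

lemma fracI: "a \<in> A \<Longrightarrow> a / N ^ k \<in> frac"
  by (auto simp: frac_def)

lemma frac_subring: "subring_c frac"
proof
  show "1 \<in> frac" using fracI[of 1 0] by simp
  fix c d assume "c \<in> frac" "d \<in> frac"
  then obtain a b k where *: "a \<in> A" "b \<in> A" "c = a / N ^ k" "d = b / N ^ k" by (rule frac_cases2)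
  show "c - d \<in> frac" using * fracI[of "a - b" k] by (simp add: diff_divide_distrib)
  show "c * d \<in> frac" using * fracI[of "a * b" "k + k"] by (simp add: power_add)
qed

lemma F_algebra: "Lie_algebra_endo frac F fsc fg"
proof -
  interpret subring_c frac by (rule frac_subring)
  show ?thesis
  proof
    show "lie_ring F" by (rule F_lie_ring)
  next
    fix c x assume "c \<in> frac" "x \<in> carrier F"
    then obtain a k v i where *: "a \<in> A" "c = a / N ^ k" "v \<in> carrier M" "x = cls v i"
      by (metis frac_cases2 F_cases)
    show "fsc c x \<in> carrier F" using * by (simp add: fsc_cls)
    show "fg (fsc c x) = fsc c (fg x)" using * by (simp add: fsc_cls fg_cls g_s)
  next
    fix c d x assume "c \<in> frac" "d \<in> frac" "x \<in> carrier F"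
    then obtain a b k v i where *: "a \<in> A" "b \<in> A" "c = a / N ^ k" "d = b / N ^ k"
      "v \<in> carrier M" "x = cls v i"
      by (metis frac_cases2 F_cases)
    have "c + d = (a + b) / N ^ k" "c * d = (a * b) / N ^ (k + k)"
      using * by (simp_all add: add_divide_distrib power_add)
    then show "fsc (c + d) x = fsc c x \<oplus>\<^bsub>F\<^esub> fsc d x" "fsc (c * d) x = fsc c (fsc d x)"
      using * by (simp_all add: fsc_cls s_add_left add_cls s_mult add_ac del: times_divide_eq_left times_divide_eq_right)
  next
    fix c x y assume "c \<in> frac" "x \<in> carrier F" "y \<in> carrier F"
    then obtain a k v w i where *: "a \<in> A" "c = a / N ^ k" "v \<in> carrier M" "w \<in> carrier M"
      "x = cls v i" "y = cls w i"
      by (metis frac_cases2 F_cases3)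
    show "fsc c (x \<oplus>\<^bsub>F\<^esub> y) = fsc c x \<oplus>\<^bsub>F\<^esub> fsc c y"
      using * by (simp add: fsc_cls add_cls s_add_right)
    show "fsc c (x \<otimes>\<^bsub>F\<^esub> y) = fsc c x \<otimes>\<^bsub>F\<^esub> y"
      using * by (simp add: fsc_cls mult_cls s_bracket_left add_ac)
  next
    fix x assume "x \<in> carrier F"
    then obtain v i where "v \<in> carrier M" "x = cls v i" by (rule F_cases)
    then show "fsc 1 x = x" using fsc_cls[of v 1 0 i] by simp
  next
    have "fg x \<in> carrier F" if "x \<in> carrier F" for x
      using that by (rule F_cases) (simp add: fg_cls)
    moreover have "fg (x \<oplus>\<^bsub>F\<^esub> y) = fg x \<oplus>\<^bsub>F\<^esub> fg y \<and> fg (x \<otimes>\<^bsub>F\<^esub> y) = fg x \<otimes>\<^bsub>F\<^esub> fg y"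
      if xy: "x \<in> carrier F" "y \<in> carrier F" for x y
    proof -
      obtain v w i where "v \<in> carrier M" "w \<in> carrier M" "x = cls v i" "y = cls w i"
        using F_cases3[OF xy(1,2,2)] by metis
      then show ?thesis by (simp add: add_cls mult_cls fg_cls g_add g_bracket)
    qed
    ultimately show "lie_endo F fg" by (auto simp: lie_endo_def)
  qed
qed

text \<open>Multiplying \<open>cls v i\<close> by \<open>N ^ i\<close> gives \<open>cls v 0\<close>,
  the image of \<open>v\<close> under an additive map commuting with the endomorphisms, so
  annihilation carries over; afterwards the unit \<open>N ^ i\<close> of \<open>frac\<close> is
  cancelled.\<close>

lemma F_act_zero:
  assumes ann: "\<And>v. v \<in> carrier M \<Longrightarrow> horner M g r v = \<zero>" and x: "x \<in> carrier F"
  shows "Lie_algebra_endo.act F fsc fg (map_poly of_int r) x = \<zero>\<^bsub>F\<^esub>"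
proof -
  interpret F: Lie_algebra_endo frac F fsc fg by (rule F_algebra)
  obtain v i where v: "v \<in> carrier M" "x = cls v i" using x by (rule F_cases)
  have Ni: "N ^ i \<in> frac" "inverse (N ^ i) \<in> frac"
    using fracI[of "N ^ i" 0] fracI[of 1 i] by (simp_all add: field_simps)
  have "fsc (N ^ i) x = cls v 0"
    using fsc_cls[OF v(1), of "N ^ i" 0 i] v by (simp add: cls_eq flip: pw_def)
  moreover have "cls (horner M g r v) 0 = horner F fg r (cls v 0)"
    by (rule additive_horner[OF abelian_group_axioms F_abelian_group, where h = "\<lambda>v. cls v 0"])
      (use v in \<open>simp_all add: add_cls fg_cls\<close>)
  ultimately have "F.act (map_poly of_int r) (fsc (N ^ i) x) = \<zero>\<^bsub>F\<^esub>"
    using v ann by (simp add: F.act_of_int flip: F_zero)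
  then have "fsc (N ^ i) (F.act (map_poly of_int r) x) = \<zero>\<^bsub>F\<^esub>"
    using F.act_s[OF F.coeffs_in_of_int Ni(1) x] by simp
  then show ?thesis
    using F.s_inverse_cancel[OF Ni(1) _ Ni(2) F.act_closed[OF F.coeffs_in_of_int x]] by simp
qed

end

subsection \<open>Integrality of the roots and units\<close>

lemma mult_zscale: "c * zscale n x = zscale n (c * x)"
  by (simp add: zscale_def)

lemma span_mult:
  assumes "x \<in> Z.span S" "\<And>s. s \<in> S \<Longrightarrow> c * s \<in> Z.span S'"
  shows "c * x \<in> Z.span S'"
proof -
  have "Z.subspace {x. c * x \<in> Z.span S'}"
    unfolding Z.subspace_def by (auto simp: distrib_left mult_zscale Z.span_zero Z.span_add Z.span_scale)
  then have "Z.span S \<subseteq> {x. c * x \<in> Z.span S'}"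
    using assms(2) by (intro Z.span_minimal) auto
  then show ?thesis using assms(1) by auto
qed

lemma relation_reduces_generators:
  assumes "finite S" "(\<Sum>x\<in>S. zscale (u x) x) = 0" "\<exists>x\<in>S. u x \<noteq> 0"
  shows "\<exists>S'. finite S' \<and> card S' < card S \<and> Z.span S' = Z.span S"
  using assms
proof (induction "\<Sum>x\<in>S. nat \<bar>u x\<bar>" arbitrary: S u rule: less_induct)
  case less
  show ?case
  proof (cases "0 \<in> S")
    case True
    have "x \<in> Z.span (S - {0})" if "x \<in> S" for x
      using that by (cases "x = 0") (simp_all add: Z.span_zero Z.span_base)
    then have "Z.span (S - {0}) = Z.span S"
      by (intro Z.span_eq[THEN iffD2] conjI subsetI) (simp_all add: Z.span_base)
    moreover have "card (S - {0}) < card S" using True less.prems(1) by (intro card_Diff1_less)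
    ultimately show ?thesis using less.prems(1) by blast
  next
    case z: False
    obtain p where p: "p \<in> S" "u p \<noteq> 0" using less.prems by auto
    \<comment> \<open>A single nonzero coefficient would force \<open>p = 0\<close>;
      torsion-freeness of \<complex> enters here.\<close>
    have "\<exists>q\<in>S. q \<noteq> p \<and> u q \<noteq> 0"
    proof (rule ccontr)
      assume "\<not> ?thesis"
      then have "(\<Sum>x\<in>S. zscale (u x) x) = (\<Sum>x\<in>{p}. zscale (u x) x)"
        using p less.prems(1) by (intro sum.mono_neutral_right) (auto simp: zscale_def)
      then show False using less.prems(2) p z by (auto simp: zscale_def)
    qed
    then obtain q where q: "q \<in> S" "q \<noteq> p" "u q \<noteq> 0" by auto
    obtain v w where vw: "v \<in> S" "w \<in> S" "v \<noteq> w" "u v \<noteq> 0" "u w \<noteq> 0" "\<bar>u w\<bar> \<le> \<bar>u v\<bar>"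
      using p q by (cases "\<bar>u p\<bar> \<le> \<bar>u q\<bar>") (metis, metis linear)
    \<comment> \<open>The sign is chosen so that
      \<open>u v * v + u w * w = (u v - e * u w) * v + u w * (w + e * v)\<close> lowers the absolute
      coefficient of \<open>v\<close> by that of \<open>w\<close>.\<close>
    define e where "e = sgn (u v) * sgn (u w)"
    define w' where "w' = w + zscale e v"
    define S' where "S' = insert w' (S - {w})"
    have e: "e = 1 \<or> e = - 1" using vw by (auto simp: e_def sgn_if)
    have uv: "\<bar>u v - e * u w\<bar> = \<bar>u v\<bar> - \<bar>u w\<bar>"
      using vw by (auto simp: e_def sgn_if)
    have finS': "finite S'" using less.prems(1) by (simp add: S'_def)
    have "w' \<in> Z.span S" unfolding w'_def using vw by (intro Z.span_add Z.span_scale Z.span_base)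
    moreover have "w \<in> Z.span S'"
    proof -
      have "w' - zscale e v \<in> Z.span S'"
        using vw by (intro Z.span_diff Z.span_scale Z.span_base) (auto simp: S'_def)
      then show ?thesis by (simp add: w'_def)
    qed
    ultimately have span: "Z.span S' = Z.span S"
    proof (intro Z.span_eq[THEN iffD2] conjI)
      show "S' \<subseteq> Z.span S" if "w' \<in> Z.span S" using that by (auto simp: S'_def intro: Z.span_base)
      show "S \<subseteq> Z.span S'" if "w \<in> Z.span S'"
      proof
        fix x assume "x \<in> S"
        then show "x \<in> Z.span S'" using that by (cases "x = w") (auto simp: S'_def intro: Z.span_base)
      qed
    qed
    have card: "card (S - {w}) < card S" using less.prems(1) vw by (intro card_Diff1_less)
    show ?thesis
    proof (cases "w' \<in> S - {w}")
      \<comment> \<open>The new generator is already present, so the set has shrunk.\<close>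
      case True
      then have "S' = S - {w}" by (auto simp: S'_def)
      then show ?thesis using card span finS' by auto
    next
      case False
      have cS': "card S' = card S"
        unfolding S'_def using False less.prems(1) card_Suc_Diff1[of S w] vw(2)
        by (simp del: card_Diff_insert card_Diff_singleton)
      define u' where "u' = u(v := u v - e * u w, w' := u w)"
      have vw': "v \<noteq> w'" using False vw by auto
      define T where "T = S - {w} - {v}"
      have S'_eq: "S' = insert w' (insert v T)" and S_eq: "S = insert w (insert v T)"
        using vw by (auto simp: S'_def T_def)
      have T: "finite T" "v \<notin> T" "w \<notin> T" "w' \<notin> T"
        using less.prems(1) False by (auto simp: T_def)
      have sum': "(\<Sum>x\<in>S'. F x) = F w' + (F v + (\<Sum>x\<in>T. F x))" for F :: "complex \<Rightarrow> 'b::comm_monoid_add"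
        unfolding S'_eq using T vw' by simp
      have sum: "(\<Sum>x\<in>S. F x) = F w + (F v + (\<Sum>x\<in>T. F x))" for F :: "complex \<Rightarrow> 'b::comm_monoid_add"
        unfolding S_eq using T vw by simp
      have uT: "x \<in> T \<Longrightarrow> u' x = u x" for x using T by (auto simp: u'_def)
      have u'w: "u' w' = u w" "u' v = u v - e * u w" using vw' by (auto simp: u'_def)
      have tail: "(\<Sum>x\<in>T. zscale (u' x) x) = (\<Sum>x\<in>T. zscale (u x) x)"
        "(\<Sum>x\<in>T. nat \<bar>u' x\<bar>) = (\<Sum>x\<in>T. nat \<bar>u x\<bar>)"
        by (intro sum.cong refl; simp add: uT)+
      have "(\<Sum>x\<in>S'. zscale (u' x) x) = (\<Sum>x\<in>S. zscale (u x) x)"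
        unfolding sum' sum tail u'w by (simp add: w'_def zscale_def algebra_simps)
      then have "(\<Sum>x\<in>S'. zscale (u' x) x) = 0" using less.prems(2) by simp
      moreover have "(\<Sum>x\<in>S'. nat \<bar>u' x\<bar>) < (\<Sum>x\<in>S. nat \<bar>u x\<bar>)"
        unfolding sum' sum tail u'w uv using vw by auto
      moreover have "\<exists>x\<in>S'. u' x \<noteq> 0" using vw u'w by (auto simp: S'_def)
      ultimately show ?thesis using less.hyps[of u' S'] finS' cS' span by auto
    qed
  qed
qed

text \<open>A generating set of least cardinality admits no nontrivial relation.\<close>

lemma finitely_generated_free:
  assumes "finite S"
  obtains B where "finite B" "Z.independent B" "Z.span B = Z.span S"
proof -
  let ?P = "\<lambda>B. finite B \<and> Z.span B = Z.span S"
  obtain B where B: "?P B" "\<And>B'. ?P B' \<Longrightarrow> card B \<le> card B'"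
    using ex_has_least_nat[of ?P S card] assms by auto
  have "Z.independent B"
  proof
    assume "Z.dependent B"
    then obtain u where "(\<Sum>x\<in>B. zscale (u x) x) = 0" "\<exists>x\<in>B. u x \<noteq> 0"
      using B(1) by (auto simp: Z.dependent_finite)
    then show False using relation_reduces_generators[of B u] B by (metis leD)
  qed
  then show thesis using that B(1) by blast
qed

section \<open>Rings generated by integral elements\<close>

definition integral_c :: "complex \<Rightarrow> bool" where
  "integral_c x \<longleftrightarrow> (\<exists>n c. x ^ n = (\<Sum>j<n. zscale (c j) (x ^ j)))"

text \<open>Adjoining an integral \<open>m\<close> of degree \<open>n\<close> multiplies the old
  generators by the powers of \<open>m\<close> below \<open>n\<close>; the integral equation
  rewrites \<open>m ^ n\<close>.\<close>

lemma integral_ring_finitely_generated: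
  assumes "finite R" "\<And>x. x \<in> R \<Longrightarrow> integral_c x"
  shows "\<exists>S. finite S \<and> 1 \<in> Z.span S \<and> R \<subseteq> Z.span S \<and>
    (\<forall>x\<in>Z.span S. \<forall>y\<in>Z.span S. x * y \<in> Z.span S)"
  using assms
proof (induction R rule: finite_induct)
  case empty
  have "x * y \<in> Z.span {1}" if "x \<in> Z.span {1}" "y \<in> Z.span {1}" for x y
    using that(2) by (rule span_mult) (use that(1) in simp)
  then show ?case by (intro exI[of _ "{1}"]) (auto intro: Z.span_base)
next
  case (insert m R)
  obtain S where S: "finite S" "1 \<in> Z.span S" "R \<subseteq> Z.span S"
    "\<And>x y. x \<in> Z.span S \<Longrightarrow> y \<in> Z.span S \<Longrightarrow> x * y \<in> Z.span S"
    using insert by auto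
  obtain n c where n: "m ^ n = (\<Sum>j<n. zscale (c j) (m ^ j))"
    using insert.prems[of m] by (auto simp: integral_c_def)
  \<comment> \<open>For \<open>n = 0\<close> the equation would read \<open>1 = 0\<close>.\<close>
  have n0: "n > 0" using n by (cases n) auto
  define S' where "S' = (\<lambda>(x, j). m ^ j * x) ` (S \<times> {..<n})"
  have base: "m ^ j * x \<in> Z.span S'" if "x \<in> Z.span S" "j < n" for x j
    using that(1) by (rule span_mult) (use that(2) in \<open>auto simp: S'_def intro!: Z.span_base\<close>)
  have SS': "x \<in> Z.span S'" if "x \<in> Z.span S" for x
    using base[OF that n0] by simp
  have mS': "m * x \<in> Z.span S'" if "x \<in> Z.span S'" for x
    using that
  proof (rule span_mult)
    fix y assume "y \<in> S'"
    then obtain x j where y: "y = m ^ j * x" "x \<in> S" "j < n" by (auto simp: S'_def)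
    show "m * y \<in> Z.span S'"
    proof (cases "Suc j < n")
      case True
      then show ?thesis using base[of x "Suc j"] y Z.span_base[of x S] by (simp add: mult.assoc)
    next
      case False
      then have "n = Suc j" using y by auto
      then have "m * y = m ^ n * x" using y by simp
      also have "\<dots> = (\<Sum>j<n. zscale (c j) (m ^ j * x))"
        unfolding n by (simp add: sum_distrib_right zscale_def mult.assoc)
      also have "\<dots> \<in> Z.span S'"
        using base Z.span_base[OF y(2)] by (intro Z.span_sum Z.span_scale) auto
      finally show ?thesis .
    qed
  qed
  have mpow: "m ^ j * x \<in> Z.span S'" if "x \<in> Z.span S'" for x j
    by (induction j) (use that mS' in \<open>auto simp: mult.assoc\<close>)
  have sS': "x * y \<in> Z.span S'" if x: "x \<in> Z.span S" and y: "y \<in> Z.span S'" for x y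
    using y
  proof (rule span_mult)
    fix y assume "y \<in> S'"
    then obtain z j where y: "y = m ^ j * z" "z \<in> S" "j < n" by (auto simp: S'_def)
    have "m ^ j * (x * z) \<in> Z.span S'"
      using y by (intro base S(4) x) (auto intro: Z.span_base)
    then show "x * y \<in> Z.span S'" using y by (simp add: mult.left_commute)
  qed
  have prod: "x * y \<in> Z.span S'" if x: "x \<in> Z.span S'" and y: "y \<in> Z.span S'" for x y
    using y
  proof (rule span_mult)
    fix y assume "y \<in> S'"
    then obtain z j where yz: "y = m ^ j * z" "z \<in> S" "j < n" by (auto simp: S'_def)
    have "m ^ j * (z * x) \<in> Z.span S'"
      using yz x by (intro mpow sS') (auto intro: Z.span_base)
    then show "x * y \<in> Z.span S'" using yz by (simp add: mult_ac)
  qed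
  have "m \<in> Z.span S'" using mS'[OF SS'[OF S(2)]] by simp
  moreover have "finite S'" using S(1) by (simp add: S'_def)
  moreover have "R \<subseteq> Z.span S'" using SS' S(3) by blast
  moreover note SS'[OF S(2)]
  moreover have "\<forall>x\<in>Z.span S'. \<forall>y\<in>Z.span S'. x * y \<in> Z.span S'" by (intro ballI prod)
  ultimately show ?case by (intro exI[of _ S'] conjI) simp_all
qed

text \<open>The left side counts the powers of \<open>a\<close> that clear denominators: one for
  each of the \<open>m\<close> copies of a difference of roots, \<open>2 * d\<close> for each value
  of \<open>r\<close> at a product of roots. The right side is the exponent of \<open>a\<close> in
  \<open>N\<close>, less one.\<close>

lemma exponent_bound:
  fixes l m d q1 q2 :: nat
  assumes "m + l \<le> d + 1" "m > 0" "q1 \<le> l\<^sup>2" "q2 \<le> l\<^sup>2"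
  shows "m * q1 + 2 * d * q2 \<le> 2 * d\<^sup>2 + 2 * d ^ 3"
proof -
  have "l \<le> d" using assms(1,2) by simp
  then obtain e where d: "d = l + e" using le_Suc_ex by blast
  have m: "m \<le> e + 1" using assms(1) d by simp
  have "m * q1 + 2 * d * q2 \<le> (e + 1) * l\<^sup>2 + 2 * d * l\<^sup>2"
    using m assms by (intro add_mono mult_mono) auto
  also have "\<dots> \<le> 2 * d\<^sup>2 + 2 * d ^ 3"
    unfolding d by (simp add: power2_eq_square power3_eq_cube algebra_simps)
  finally show ?thesis .
qed

section \<open>Roots, multiplicities and divisors of \<open>N\<close>\<close>

context
  fixes r :: "int poly"
  assumes deg: "degree r > 0"
begin

abbreviation (input) "rc \<equiv> map_poly (of_int :: int \<Rightarrow> complex) r"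
abbreviation (input) "lc \<equiv> of_int (lead_coeff r) :: complex"

lemma degree_rc [simp]: "degree rc = degree r"
  by (rule degree_map_poly) auto

lemma lc_nz: "lc \<noteq> 0"
  using deg by auto

lemma lead_coeff_rc: "lead_coeff rc = lc"
  by (simp add: coeff_map_poly)

lemma rc_nz: "rc \<noteq> 0"
  using deg degree_rc by (metis degree_0 less_numeral_extra(3))

lemma finite_roots_c: "finite (roots_c r)"
  unfolding roots_c_def using rc_nz by (rule poly_roots_finite)

lemma rc_decompose: "rc = smult lc (\<Prod>z\<in>roots_c r. lin z ^ order z rc)"
  using complex_poly_decompose[of rc] unfolding lead_coeff_rc roots_c_def lin_def by simp

lemma order_pos: "x \<in> roots_c r \<Longrightarrow> order x rc > 0"
  using rc_nz order_root[of rc x] by (auto simp: roots_c_def)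

lemma sum_order: "(\<Sum>x\<in>roots_c r. order x rc) = degree r"
proof -
  have "degree r = degree (smult lc (\<Prod>z\<in>roots_c r. lin z ^ order z rc))"
    using rc_decompose degree_rc by metis
  also have "\<dots> = degree (\<Prod>z\<in>roots_c r. lin z ^ order z rc)" using lc_nz by simp
  also have "\<dots> = (\<Sum>z\<in>roots_c r. degree (lin z ^ order z rc))"
    by (rule degree_prod_sum_eq) (simp add: lin_def)
  also have "\<dots> = (\<Sum>z\<in>roots_c r. order z rc)"
    by (simp add: lin_def degree_power_eq)
  finally show ?thesis by simp
qed

lemma roots_nonempty: "roots_c r \<noteq> {}"
  using sum_order deg by auto

definition mmax :: nat where
  "mmax = Max ((\<lambda>x. order x rc) ` roots_c r)"

text \<open>A root of maximal multiplicity uses up \<open>mmax\<close> of the degree, and every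
  other root at least one.\<close>

lemma mmax_pos: "mmax > 0"
  and mmax_card: "mmax + card (roots_c r) \<le> degree r + 1"
proof -
  have "mmax \<in> (\<lambda>x. order x rc) ` roots_c r"
    unfolding mmax_def using finite_roots_c roots_nonempty by (intro Max_in) auto
  then obtain x where x: "x \<in> roots_c r" "mmax = order x rc" by auto
  then show "mmax > 0" using order_pos by simp
  have "card (roots_c r - {x}) \<le> (\<Sum>y\<in>roots_c r - {x}. order y rc)"
    using sum_mono[of "roots_c r - {x}" "\<lambda>_. 1" "\<lambda>y. order y rc"] order_pos by (force simp: Suc_le_eq)
  moreover have "degree r = mmax + (\<Sum>y\<in>roots_c r - {x}. order y rc)"
    using sum_order x finite_roots_c by (simp add: sum.remove)
  moreover have "card (roots_c r) = card (roots_c r - {x}) + 1"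
    using card_Suc_Diff1[OF finite_roots_c x(1)] by linarith
  ultimately show "mmax + card (roots_c r) \<le> degree r + 1" by simp
qed

abbreviation (input) "Q1 \<equiv> {(x, y). x \<in> roots_c r \<and> y \<in> roots_c r \<and> x \<noteq> y}"
abbreviation (input) "Q2 \<equiv> {(x, y). x \<in> roots_c r \<and> y \<in> roots_c r \<and> poly rc (x * y) \<noteq> 0}"

lemma Q_finite: "finite Q1" "finite Q2"
  and Q_card: "card Q1 \<le> card (roots_c r) ^ 2" "card Q2 \<le> card (roots_c r) ^ 2"
proof -
  have sub: "Q1 \<subseteq> roots_c r \<times> roots_c r" "Q2 \<subseteq> roots_c r \<times> roots_c r" by auto
  have fin: "finite (roots_c r \<times> roots_c r)" using finite_roots_c by simp
  show "finite Q1" "finite Q2" using sub fin finite_subset by blast+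
  show "card Q1 \<le> card (roots_c r) ^ 2" "card Q2 \<le> card (roots_c r) ^ 2"
    using card_mono[OF fin sub(1)] card_mono[OF fin sub(2)]
    by (simp_all add: card_cartesian_product power2_eq_square)
qed

lemma Discr_star_eq: "Discr_star r = lc ^ (1 + 2 * (degree r)\<^sup>2) * of_nat (fact (mmax - 1)) *
    (\<Prod>p\<in>Q1. (fst p - snd p) ^ mmax)"
  using deg by (simp add: Discr_star_def mmax_def Let_def case_prod_beta)

lemma Prod_star_eq: "Prod_star r = lc ^ (2 * degree r ^ 3) * (\<Prod>p\<in>Q2. poly rc (fst p * snd p))"
  using deg by (simp add: Prod_star_def Let_def case_prod_beta)

lemma Discr_Prod_nz: "Discr_star r * Prod_star r \<noteq> 0"
  unfolding Discr_star_eq Prod_star_eq using Q_finite lc_nz by (auto simp: case_prod_beta)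

text \<open>Multiply \<open>r(x) = 0\<close> by \<open>lc ^ (d - 1)\<close>, where \<open>d\<close>
  is the degree; this makes the equation monic in \<open>lc * x\<close>, with the coefficients
  \<open>c j\<close>.\<close>

lemma integral_lc_root: assumes "x \<in> roots_c r" shows "integral_c (lc * x)"
proof -
  let ?d = "degree r"
  define c where "c j = - (coeff r j * lead_coeff r ^ (?d - 1 - j))" for j
  have "0 = lc ^ (?d - 1) * poly rc x" using assms by (simp add: roots_c_def)
  also have "\<dots> = (\<Sum>j\<le>?d. lc ^ (?d - 1) * (of_int (coeff r j) * x ^ j))"
    by (simp add: poly_altdef coeff_map_poly sum_distrib_left)
  also have "\<dots> = (\<Sum>j<?d. lc ^ (?d - 1) * (of_int (coeff r j) * x ^ j)) + lc ^ (?d - 1) * (lc * x ^ ?d)"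
    by (subst lessThan_Suc_atMost[symmetric]) simp
  also have "lc ^ (?d - 1) * (lc * x ^ ?d) = (lc * x) ^ ?d"
    using deg by (simp add: power_mult_distrib mult.assoc[symmetric] flip: power_Suc2)
  also have "(\<Sum>j<?d. lc ^ (?d - 1) * (of_int (coeff r j) * x ^ j)) =
      (\<Sum>j<?d. - zscale (c j) ((lc * x) ^ j))"
  proof (intro sum.cong refl)
    fix j assume "j \<in> {..<?d}"
    then have "lc ^ (?d - 1) = lc ^ (?d - 1 - j) * lc ^ j" by (simp flip: power_add)
    then show "lc ^ (?d - 1) * (of_int (coeff r j) * x ^ j) = - zscale (c j) ((lc * x) ^ j)"
      by (simp add: zscale_def c_def power_mult_distrib)
  qed
  finally have "(lc * x) ^ ?d = (\<Sum>j<?d. zscale (c j) ((lc * x) ^ j))"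
    by (simp add: sum_negf)
  then show ?thesis unfolding integral_c_def by blast
qed

text \<open>The powers of \<open>lc\<close> in \<open>N\<close> are distributed over the other
  factors to bring each of them into \<open>A\<close>, and one power remains. It is what later
  inverts \<open>lc\<close> along with \<open>N\<close>.\<close>

lemma lc_dvd_Discr_Prod:
  assumes "subring_c A" and x: "\<And>x. x \<in> roots_c r \<Longrightarrow> lc * x \<in> A"
  shows "\<exists>y\<in>A. Discr_star r * Prod_star r = lc * y"
proof -
  interpret subring_c A by fact
  let ?d = "degree r"
  have 1: "lc * (x - y) \<in> A" if "x \<in> roots_c r" "y \<in> roots_c r" for x y
    using diff_in[OF x[OF that(1)] x[OF that(2)]] by (simp add: algebra_simps)
  \<comment> \<open>The term of degree \<open>j\<close> needs \<open>lc ^ (2 * j)\<close>, one power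
    for each root in \<open>(x * y) ^ j\<close>, and \<open>j\<close> is at most the degree.\<close>
  have 2: "lc ^ (2 * ?d) * poly rc (x * y) \<in> A" if xy: "x \<in> roots_c r" "y \<in> roots_c r" for x y
  proof -
    have "lc ^ (2 * ?d) * poly rc (x * y) =
        (\<Sum>j\<le>?d. of_int (coeff r j) * lc ^ (2 * (?d - j)) * ((lc * x) * (lc * y)) ^ j)"
      unfolding poly_altdef sum_distrib_left degree_rc
    proof (intro sum.cong refl)
      fix j assume "j \<in> {..?d}"
      then have "lc ^ (2 * ?d) = lc ^ (2 * (?d - j)) * (lc ^ j * lc ^ j)"
        by (simp flip: power_add mult_2 add: algebra_simps)
      then show "lc ^ (2 * ?d) * (coeff rc j * (x * y) ^ j) =
          of_int (coeff r j) * lc ^ (2 * (?d - j)) * ((lc * x) * (lc * y)) ^ j"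
        by (simp add: coeff_map_poly power_mult_distrib)
    qed
    also have "\<dots> \<in> A"
      by (intro sum_in mult_in[OF mult_in[OF of_int_in power_in[OF of_int_in]] power_in[OF mult_in]] x xy)
    finally show ?thesis .
  qed
  \<comment> \<open>The surplus exponent; the natural-number subtraction is exact by
    \<open>exponent_bound\<close>.\<close>
  define e where "e = 2 * ?d\<^sup>2 + 2 * ?d ^ 3 - (mmax * card Q1 + 2 * ?d * card Q2)"
  have e: "1 + 2 * ?d\<^sup>2 + 2 * ?d ^ 3 = 1 + e + mmax * card Q1 + 2 * ?d * card Q2"
    using exponent_bound[OF mmax_card mmax_pos Q_card] unfolding e_def by simp
  define y where "y = lc ^ e * of_nat (fact (mmax - 1)) * (\<Prod>p\<in>Q1. (lc * (fst p - snd p)) ^ mmax) *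
      (\<Prod>p\<in>Q2. lc ^ (2 * ?d) * poly rc (fst p * snd p))"
  have Q1A: "(\<Prod>p\<in>Q1. (lc * (fst p - snd p)) ^ mmax) \<in> A"
    by (intro prod_in power_in 1) auto
  have Q2A: "(\<Prod>p\<in>Q2. lc ^ (2 * ?d) * poly rc (fst p * snd p)) \<in> A"
    by (intro prod_in 2) auto
  have "y \<in> A" unfolding y_def
    by (rule mult_in[OF mult_in[OF mult_in[OF power_in[OF of_int_in] of_nat_in] Q1A] Q2A])
  have P1: "(\<Prod>p\<in>Q1. (lc * (fst p - snd p)) ^ mmax) = lc ^ (mmax * card Q1) * (\<Prod>p\<in>Q1. (fst p - snd p) ^ mmax)"
    by (simp add: power_mult_distrib prod.distrib power_mult)
  have P2: "(\<Prod>p\<in>Q2. lc ^ (2 * ?d) * poly rc (fst p * snd p)) =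
      lc ^ (2 * ?d * card Q2) * (\<Prod>p\<in>Q2. poly rc (fst p * snd p))"
    by (simp add: prod.distrib power_mult)
  have "Discr_star r * Prod_star r = lc ^ (1 + 2 * ?d\<^sup>2 + 2 * ?d ^ 3) * of_nat (fact (mmax - 1)) *
    (\<Prod>p\<in>Q1. (fst p - snd p) ^ mmax) * (\<Prod>p\<in>Q2. poly rc (fst p * snd p))"
    unfolding Discr_star_eq Prod_star_eq power_add by (simp only: mult_ac)
  also have "\<dots> = lc * y"
    unfolding e y_def P1 P2 power_add by (simp only: mult_ac power_one_right)
  finally show ?thesis using \<open>y \<in> A\<close> by blast
qed

text \<open>Differences of roots divide \<open>Discr_star r\<close>, and values of \<open>r\<close>
  at products of roots that are not roots divide \<open>Prod_star r\<close>; the cofactors lie in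
  \<open>A\<close>, so these divisors are units.\<close>

lemma unit_differences:
  assumes "subring_c A" and x: "\<And>x. x \<in> roots_c r \<Longrightarrow> x \<in> A"
    and inv: "inverse (Discr_star r * Prod_star r) \<in> A"
  shows "x \<in> roots_c r \<Longrightarrow> y \<in> roots_c r \<Longrightarrow> x \<noteq> y \<Longrightarrow> inverse (x - y) \<in> A"
    and "x \<in> roots_c r \<Longrightarrow> y \<in> roots_c r \<Longrightarrow> z \<in> roots_c r \<Longrightarrow> x * y \<noteq> z \<Longrightarrow> inverse (x * y - z) \<in> A"
proof -
  interpret subring_c A by fact
  have rcA: "poly rc c \<in> A" if "c \<in> A" for c
    unfolding poly_altdef using that by (intro sum_in mult_in power_in) (auto simp: coeff_map_poly)
  have prodD: "inverse (f i) \<in> A"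
    if "finite I" "i \<in> I" "\<And>i. i \<in> I \<Longrightarrow> f i \<in> A" "prod f I \<noteq> 0" "inverse (prod f I) \<in> A" for f and i :: 'b and I
    using that by (intro inverse_factor_in[of "f i" "prod f (I - {i})" "prod f I"])
      (auto simp: prod.remove)
  have powD: "inverse c \<in> A" if "c \<in> A" "n > 0" "c \<noteq> 0" "inverse (c ^ n) \<in> A" for c n
    using that by (intro inverse_factor_in[of c "c ^ (n - 1)" "c ^ n"]) (auto simp flip: power_Suc)
  let ?E = "Discr_star r * Prod_star r"
  let ?p1 = "\<Prod>p\<in>Q1. (fst p - snd p) ^ mmax" and ?p2 = "\<Prod>p\<in>Q2. poly rc (fst p * snd p)"
  let ?c = "lc ^ (1 + 2 * (degree r)\<^sup>2) * of_nat (fact (mmax - 1)) * lc ^ (2 * degree r ^ 3)"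
  have E: "?p1 * (?c * ?p2) = ?E" "?p2 * (?c * ?p1) = ?E"
    unfolding Discr_star_eq Prod_star_eq by (simp_all only: mult_ac)
  have nz: "?p1 \<noteq> 0" "?p2 \<noteq> 0" using Discr_Prod_nz unfolding Discr_star_eq Prod_star_eq by auto
  have cA: "?c \<in> A" by (intro mult_in power_in of_int_in of_nat_in)
  have p1A: "?p1 \<in> A" using x by (intro prod_in power_in diff_in) auto
  have p2A: "?p2 \<in> A" using x by (intro prod_in rcA mult_in) auto
  have i1: "inverse ?p1 \<in> A"
    by (rule inverse_factor_in[OF E(1) _ Discr_Prod_nz inv]) (use cA p2A in auto)
  have i2: "inverse ?p2 \<in> A"
    by (rule inverse_factor_in[OF E(2) _ Discr_Prod_nz inv]) (use cA p1A in auto)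
  show *: "inverse (x - y) \<in> A" if "x \<in> roots_c r" "y \<in> roots_c r" "x \<noteq> y" for x y
  proof (rule powD[OF _ mmax_pos])
    show "inverse ((x - y) ^ mmax) \<in> A"
      using prodD[OF Q_finite(1) _ _ nz(1) i1, of "(x, y)"] that x by auto
  qed (use that x in auto)
  show "inverse (x * y - z) \<in> A"
    if "x \<in> roots_c r" "y \<in> roots_c r" "z \<in> roots_c r" "x * y \<noteq> z" for x y z
  proof (cases "x * y \<in> roots_c r")
    \<comment> \<open>Here \<open>poly rc (x * y)\<close> is a factor of \<open>Prod_star r\<close>,
      hence a unit, and \<open>x * y - z\<close> is one of its linear factors.\<close>
    case False
    then have nzr: "poly rc (x * y) \<noteq> 0" by (simp add: roots_c_def)
    then have i3: "inverse (poly rc (x * y)) \<in> A"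
      using prodD[OF Q_finite(2) _ _ nz(2) i2, of "(x, y)"] that(1,2) x rcA by auto
    let ?q = "\<Prod>w\<in>roots_c r. (x * y - w) ^ order w rc"
    have q: "poly rc (x * y) = lc * ?q"
      by (subst rc_decompose) (simp add: poly_prod lin_def)
    have "inverse ?q \<in> A"
      by (rule inverse_factor_in[OF _ _ nzr i3, of _ lc]) (auto simp: q)
    then have "inverse ((x * y - z) ^ order z rc) \<in> A"
      using prodD[OF finite_roots_c that(3), of "\<lambda>w. (x * y - w) ^ order w rc"] nzr q x that by auto
    then show ?thesis by (rule powD[rotated 3]) (use that x order_pos in auto)
  qed (use that * in auto)
qed

lemma root_algebraic: "x \<in> roots_c r \<Longrightarrow> algebraic x"
  using rc_nz by (intro algebraicI[of rc]) (auto simp: roots_c_def coeff_map_poly)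

end

subsection \<open>The embedding\<close>

text \<open>Translates \<open>poly_annihilates\<close> into Horner form. The free bound
  \<open>n\<close> lets the induction pass from \<open>pCons c p\<close> with bound
  \<open>Suc m\<close> to \<open>p\<close> with bound \<open>m\<close>.\<close>

lemma (in Lie_ring) horner_eq_finsum:
  assumes g: "lie_endo M g" and v: "v \<in> carrier M" and "degree r \<le> n"
  shows "horner M g r v \<in> carrier M \<and> horner M g r v = (\<Oplus>i\<in>{..n}. [coeff r i] \<cdot> ((g ^^ i) v))"
  using assms(3)
proof (induction r arbitrary: n)
  case 0
  have "(\<Oplus>i\<in>{..n}. [coeff (0 :: int poly) i] \<cdot> ((g ^^ i) v)) = \<zero>"
    by (rule add.finprod_one_eqI) (simp add: add_pow_def)
  then show ?case by (simp add: horner_def)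
next
  case (pCons c p)
  have gcl: "x \<in> carrier M \<Longrightarrow> g x \<in> carrier M"
    and gadd: "x \<in> carrier M \<Longrightarrow> y \<in> carrier M \<Longrightarrow> g (x \<oplus> y) = g x \<oplus> g y" for x y
    using g unfolding lie_endo_def by blast+
  have gpow: "(g ^^ i) v \<in> carrier M" for i by (induction i) (use v gcl in auto)
  have step: "horner M g (pCons c p) v = [c] \<cdot> v \<oplus> g (horner M g p v)"
    using pCons.hyps by (auto simp: horner_def cCons_def)
  have cl: "horner M g p v \<in> carrier M" using pCons.IH[OF order_refl] by (rule conjunct1)
  show ?case
  proof (cases n)
    case 0
    then have "p = 0" using pCons.prems by (cases "p = 0") auto
    moreover have "g \<zero> = \<zero>"
      by (rule additive_zero[OF abelian_group_axioms abelian_group_axioms]) (auto simp: gcl gadd)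
    ultimately show ?thesis using step v 0 by (simp add: horner_def)
  next
    case (Suc m)
    have "degree p \<le> m" using pCons.prems Suc by (cases "p = 0") auto
    then have "g (horner M g p v) = g (\<Oplus>i\<in>{..m}. [coeff p i] \<cdot> ((g ^^ i) v))"
      using pCons.IH by simp
    also have "\<dots> = (\<Oplus>i\<in>{..m}. g ([coeff p i] \<cdot> ((g ^^ i) v)))"
      by (rule additive_finsum[OF abelian_group_axioms abelian_group_axioms])
        (auto simp: gcl gadd gpow)
    also have "\<dots> = (\<Oplus>i\<in>{..m}. [coeff p i] \<cdot> ((g ^^ Suc i) v))"
    proof (rule finsum_cong')
      fix i
      show "g ([coeff p i] \<cdot> ((g ^^ i) v)) = [coeff p i] \<cdot> ((g ^^ Suc i) v)"
        using additive_int_mult[OF abelian_group_axioms abelian_group_axioms, of g "(g ^^ i) v" "coeff p i"]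
          gcl gadd gpow by simp
    qed (use gpow gcl in auto)
    also have "[c] \<cdot> v \<oplus> \<dots> = (\<Oplus>i\<in>{..Suc m}. [coeff (pCons c p) i] \<cdot> ((g ^^ i) v))"
      using gpow[of "Suc _"] gpow v by (subst finsum_Suc2) (auto simp: a_comm)
    finally have "horner M g (pCons c p) v = (\<Oplus>i\<in>{..n}. [coeff (pCons c p) i] \<cdot> ((g ^^ i) v))"
      using step Suc by simp
    moreover have "horner M g (pCons c p) v \<in> carrier M" unfolding step using cl v gcl by simp
    ultimately show ?thesis by (intro conjI)
  qed
qed

text \<open>For constant \<open>r\<close>, zero included, \<open>r(g) = 0\<close> says that
  \<open>D\<close> kills \<open>L\<close>. The scaled ring is then zero and embeds into the zero Lie
  ring, whose support is empty.\<close>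

lemma trivial_grading:
  assumes "poly_annihilates r L g" "degree r = 0" "of_int D = Discr_star r" "lie_ring L"
  shows "\<exists>(K :: 'k list ring) Kc f. lie_ring K \<and> alg_graded K Kc \<and>
    grading_support K Kc \<subseteq> roots_c r \<and> lie_embedding_on (scaled_carrier D L) L K f"
proof -
  interpret Lie_ring L using assms(4) by unfold_locales
  have "D = coeff r 0" using assms(2,3) by (simp add: Discr_star_def)
  then have "[D] \<cdot>\<^bsub>L\<^esub> v = \<zero>\<^bsub>L\<^esub>" if "v \<in> carrier L" for v
    using assms(1,2) that by (simp add: poly_annihilates_def)
  then have sc: "scaled_carrier D L \<subseteq> {\<zero>\<^bsub>L\<^esub>}" by (auto simp: scaled_carrier_def)
  define K :: "'k list ring" where
    "K = \<lparr>carrier = {[]}, monoid.mult = (\<lambda>_ _. []), monoid.one = [], ring.zero = [], ring.add = (\<lambda>_ _. [])\<rparr>"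
  have ab: "abelian_group K" by (rule abelian_groupI) (auto simp: K_def)
  interpret K: abelian_group K by (rule ab)
  have "subgroup {[]} (add_monoid K)"
    by (rule K.add.subgroupI) (auto simp: K_def K.add.inv_closed[unfolded K_def, simplified])
  moreover have "\<exists>!f. (\<forall>s. algebraic s \<longrightarrow> f s \<in> {[]}) \<and> (\<forall>s. \<not> algebraic s \<longrightarrow> f s = \<zero>\<^bsub>K\<^esub>) \<and>
      finite {s::complex. f s \<noteq> \<zero>\<^bsub>K\<^esub>} \<and> x = (\<Oplus>\<^bsub>K\<^esub>s\<in>{s. f s \<noteq> \<zero>\<^bsub>K\<^esub>}. f s)" if "x \<in> carrier K" for x
  proof (rule ex1I[of _ "\<lambda>_. []"])
    show "f = (\<lambda>_. [])" if "(\<forall>s. algebraic s \<longrightarrow> f s \<in> {[]}) \<and> (\<forall>s. \<not> algebraic s \<longrightarrow> f s = \<zero>\<^bsub>K\<^esub>) \<and>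
      finite {s::complex. f s \<noteq> \<zero>\<^bsub>K\<^esub>} \<and> x = (\<Oplus>\<^bsub>K\<^esub>s\<in>{s. f s \<noteq> \<zero>\<^bsub>K\<^esub>}. f s)" for f
    proof
      fix s
      show "f s = []" using that by (cases "algebraic s") (auto simp: K_def)
    qed
    have "\<zero>\<^bsub>K\<^esub> = []" "x = []" using \<open>x \<in> carrier K\<close> by (auto simp: K_def)
    then show "(\<forall>s. algebraic s \<longrightarrow> [] \<in> {[]}) \<and> (\<forall>s. \<not> algebraic s \<longrightarrow> [] = \<zero>\<^bsub>K\<^esub>) \<and>
      finite {s::complex. [] \<noteq> \<zero>\<^bsub>K\<^esub>} \<and> x = (\<Oplus>\<^bsub>K\<^esub>s\<in>{s. [] \<noteq> \<zero>\<^bsub>K\<^esub>}. [])" by simp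
  qed
  ultimately have "alg_graded K (\<lambda>_. {[]})"
    unfolding alg_graded_def by (intro conjI allI ballI impI) (auto simp: K_def)
  moreover have "lie_ring K" using ab by (auto simp: lie_ring_def K_def)
  moreover have "grading_support K (\<lambda>_. {[]}) \<subseteq> roots_c r" by (auto simp: grading_support_def K_def)
  moreover have "lie_embedding_on (scaled_carrier D L) L K (\<lambda>_. [])"
    using sc by (auto simp: lie_embedding_on_def K_def inj_on_def)
  ultimately show ?thesis by blast
qed

text \<open>The head of the list stores the exponent in its complex component, and the tail lists
  the coordinates along \<open>bs\<close>; \<open>undefined\<close> and \<open>0\<close> fill the
  other components. Extensionality recovers \<open>v\<close> from its coordinates.\<close>

lemma encode_inj:
  assumes "set bs = B"
  shows "inj_on (\<lambda>(v, j). (undefined, of_nat j) # map (\<lambda>b. (v b, 0)) bs :: ('a \<times> complex) list)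
    ((B \<rightarrow>\<^sub>E X) \<times> UNIV)"
proof (rule inj_onI)
  fix p q
  assume pq: "p \<in> (B \<rightarrow>\<^sub>E X) \<times> UNIV" "q \<in> (B \<rightarrow>\<^sub>E X) \<times> UNIV"
    and eq: "(\<lambda>(v, j). (undefined, of_nat j) # map (\<lambda>b. (v b, 0)) bs :: ('a \<times> complex) list) p =
      (\<lambda>(v, j). (undefined, of_nat j) # map (\<lambda>b. (v b, 0)) bs) q"
  obtain v j w k where p: "p = (v, j)" and q: "q = (w, k)" by (cases p, cases q)
  have vw: "v \<in> B \<rightarrow>\<^sub>E X" "w \<in> B \<rightarrow>\<^sub>E X" using pq p q by auto
  have "v b = w b" if "b \<in> B" for b using eq that assms p q by auto
  then show "p = q" using eq p q PiE_ext[OF vw] by auto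
qed

theorem theorem5p2:
  fixes L :: "'a ring" and \<gamma> :: "'a \<Rightarrow> 'a" and r :: "int poly" and D P :: int
  assumes "lie_ring L"
    and "lie_endo L \<gamma>"
    and "poly_annihilates r L \<gamma>"
    and "of_int D = Discr_star r"
    and "of_int P = Prod_star r"
    and "\<not> has_torsion L (D * P)"
  shows "\<exists>(K :: ('a \<times> complex) list ring) Kc f.
           lie_ring K \<and> alg_graded K Kc \<and>
           grading_support K Kc \<subseteq> roots_c r \<and>
           lie_embedding_on (scaled_carrier D L) L K f"
proof (cases "degree r = 0")
  case True
  then show ?thesis using trivial_grading assms by blast
next
  case False
  then have deg: "degree r > 0" by simp
  interpret L: Lie_ring L using assms(1) by unfold_locales
  define lc :: complex where "lc = of_int (lead_coeff r)"
  define N :: complex where "N = of_int (D * P)"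
  have N: "N = Discr_star r * Prod_star r" using assms(4,5) by (simp add: N_def)
  have N_nz: "N \<noteq> 0" using Discr_Prod_nz[OF deg] N by simp
  have "\<exists>S. finite S \<and> 1 \<in> Z.span S \<and> (\<lambda>x. lc * x) ` roots_c r \<subseteq> Z.span S \<and>
      (\<forall>x\<in>Z.span S. \<forall>y\<in>Z.span S. x * y \<in> Z.span S)"
    using finite_roots_c[OF deg] integral_lc_root[OF deg]
    by (intro integral_ring_finitely_generated) (auto simp: lc_def)
  then obtain S where S: "finite S" "1 \<in> Z.span S" "(\<lambda>x. lc * x) ` roots_c r \<subseteq> Z.span S"
      "\<forall>x\<in>Z.span S. \<forall>y\<in>Z.span S. x * y \<in> Z.span S" by (elim exE conjE)
  obtain B where B: "finite B" "Z.independent B" "Z.span B = Z.span S"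
    using finitely_generated_free[OF S(1)] .
  interpret E: scalar_extension L B
    by unfold_locales (use B S in auto)
  obtain bs where bs: "set bs = B" using finite_list[OF B(1)] by auto
  let ?h = "\<lambda>(v, j). (undefined, of_nat j) # map (\<lambda>b. (v b, 0)) bs :: ('a \<times> complex) list"
  interpret TE: Lie_algebra_endo "Z.span B" E.T E.sc "E.lift \<gamma>" by (rule E.T_endo[OF assms(2)])
  interpret loc: localization "Z.span B" E.T E.sc "E.lift \<gamma>" N ?h
  proof unfold_locales
    show "N \<in> Z.span B" by (simp add: N_def del: of_int_mult)
    show "N \<noteq> 0" by (rule N_nz)
    \<comment> \<open>As \<open>N\<close> is an integer, acting by it is taking a multiple, so the
      torsion hypothesis gives injectivity.\<close>
    show "x = \<zero>\<^bsub>E.T\<^esub>" if "x \<in> carrier E.T" "E.sc N x = \<zero>\<^bsub>E.T\<^esub>" for x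
      using E.T_no_torsion[OF assms(6)] that TE.s_of_int[OF that(1), of "D * P"]
      by (auto simp: has_torsion_def N_def simp del: of_int_mult)
    show "inj_on ?h (carrier E.T \<times> UNIV)"
      using encode_inj[OF bs, of "carrier L"] by (simp add: E.T_def)
  qed
  interpret FE: Lie_algebra_endo loc.frac loc.F loc.fsc loc.fg by (rule loc.F_algebra)
  have frac: "c \<in> loc.frac" if "c \<in> Z.span B" for c using loc.fracI[OF that, of 0] by simp
  have invN: "inverse N \<in> loc.frac" using loc.fracI[of 1 1] by (simp add: inverse_eq_divide)
  have lcx: "lc * x \<in> Z.span B" if "x \<in> roots_c r" for x using S(3) B(3) that by auto
  \<comment> \<open>From \<open>N = lc * y\<close> with \<open>y\<close> in the span,
    \<open>1/lc = y/N\<close> is a fraction, and so is each root, as \<open>lc * x\<close> divided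
    by \<open>lc\<close>.\<close>
  obtain y where y: "y \<in> Z.span B" "N = lc * y"
    using lc_dvd_Discr_Prod[OF deg E.subring_c_axioms] lcx N by (auto simp: lc_def)
  have lc: "lc \<in> loc.frac" "lc \<noteq> 0" "inverse lc \<in> loc.frac"
    using FE.inverse_factor_in[OF y(2)[symmetric] frac[OF y(1)] N_nz invN] lc_nz[OF deg]
    by (auto simp: lc_def)
  have root: "x \<in> loc.frac" if "x \<in> roots_c r" for x
  proof -
    have "lc * x * inverse lc = x" using lc(2) by simp
    then show ?thesis using FE.mult_in[OF frac[OF lcx[OF that]] lc(3)] by (simp only:)
  qed
  have invE: "inverse (Discr_star r * Prod_star r) \<in> loc.frac" using invN by (simp only: N[symmetric])
  note ud = unit_differences[OF deg FE.subring_c_axioms root invE]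
  let ?p = "\<Prod>z\<in>roots_c r. lin z ^ order z (map_poly of_int r)"
  have pA: "coeffs_in loc.frac ?p" using root by (intro FE.coeffs_in_prod) simp
  have ann0: "horner L \<gamma> r v = \<zero>\<^bsub>L\<^esub>" if "v \<in> carrier L" for v
    using L.horner_eq_finsum[OF assms(2) that order_refl, of r] assms(3) that
    by (simp add: poly_annihilates_def)
  \<comment> \<open>\<open>eig_grading\<close> expects a product of monic linear factors, so the
    unit \<open>lc\<close> is cancelled.\<close>
  have ann: "FE.act ?p v = \<zero>\<^bsub>loc.F\<^esub>" if v: "v \<in> carrier loc.F" for v
  proof -
    have "FE.act (smult lc ?p) v = \<zero>\<^bsub>loc.F\<^esub>"
      using loc.F_act_zero[OF E.T_horner[OF assms(2) ann0] v] rc_decompose[OF deg]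
      by (simp add: lc_def)
    then have "loc.fsc lc (FE.act ?p v) = \<zero>\<^bsub>loc.F\<^esub>" using pA lc v by (simp add: FE.act_smult)
    then show ?thesis using FE.s_inverse_cancel[OF lc] pA v by simp
  qed
  let ?Kc = "\<lambda>c. if c \<in> roots_c r then FE.eig c else {\<zero>\<^bsub>loc.F\<^esub>}"
  have "alg_graded loc.F ?Kc"
  proof (rule FE.eig_grading[OF finite_roots_c[OF deg] _ _ ann])
    show "FE.unit_diff c d" if "c \<in> roots_c r" "d \<in> roots_c r" for c d
      using that ud(1) root by (auto simp: FE.unit_diff_def)
    show "FE.unit_diff (b * c) d" if "b \<in> roots_c r" "c \<in> roots_c r" "d \<in> roots_c r" for b c d
      using that ud(2) root by (auto simp: FE.unit_diff_def)
  qed (use root_algebraic[OF deg] in auto)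
  moreover have "lie_ring loc.F" by (rule loc.F_lie_ring)
  moreover have "grading_support loc.F ?Kc \<subseteq> roots_c r" by (auto simp: grading_support_def)
  \<comment> \<open>The composite of \<open>u \<mapsto> u \<otimes> 1\<close> and
    \<open>v \<mapsto> v/1\<close>; it respects brackets because \<open>1 * 1 = 1\<close> and the
    exponents add to \<open>0\<close>.\<close>
  moreover have "lie_embedding_on (scaled_carrier D L) L loc.F (\<lambda>v. loc.cls (E.tensor 1 v) 0)"
  proof -
    have sub: "scaled_carrier D L \<subseteq> carrier L" by (auto simp: scaled_carrier_def)
    have "inj_on (\<lambda>v. loc.cls (E.tensor 1 v) 0) (carrier L)"
      using inj_onD[OF E.tensor_one_inj] by (intro inj_onI) (simp add: loc.cls_eq)
    then have "inj_on (\<lambda>v. loc.cls (E.tensor 1 v) 0) (scaled_carrier D L)"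
      using sub by (rule inj_on_subset)
    then show ?thesis
      using sub unfolding lie_embedding_on_def
      by (auto simp: subset_iff loc.add_cls loc.mult_cls E.tensor_add_right E.mult_tensor)
  qed
  ultimately show ?thesis by blast
qed

end
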